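(* Let $\phi(x,y,z)$ be a non-singular homogeneous complex cubic polynomial defining the smooth plane cubic $C_\phi\subset\mathbb{P}^2$. Let $\Lambda=\omega_1\mathbb{Z}+\omega_2\mathbb{Z}$ with $\tau=\omega_2/\omega_1$, $\operatorname{Im}\tau>0$, let $g_2=60\sum_{\omega\in\Lambda\setminus\{0\}}\omega^{-4}$, $g_3=140\sum_{\omega\in\Lambda\setminus\{0\}}\omega^{-6}$, and let $\lambda_{ij}\in\mathbb{C}$ with $D=\lambda_{11}\lambda_{22}-\lambda_{12}\lambda_{21}\neq0$ be such that, as polynomials in $X,Y$, $$\phi(\lambda_{11}X+\lambda_{12}Y+\lambda_{13},\ \lambda_{21}X+\lambda_{22}Y+\lambda_{23},\ 1)=-Y^2+4X^3-g_2X-g_3,$$ so that $s\mapsto(\lambda_{11}\mathcal{P}(s)+\lambda_{12}\mathcal{P}'(s)+\lambda_{13}:\lambda_{21}\mathcal{P}(s)+\lambda_{22}\mathcal{P}'(s)+\lambda_{23}:1)$ identifies $\mathbb{C}/\Lambda$ with $C_\phi$. Let $\alpha,\gamma\in\mathbb{C}$ and suppose the line $y=\alpha x+\gamma z$ meets $C_\phi$ in three distinct points $P_i=(1:\alpha+\gamma\beta_i:\beta_i)$, $\beta_i\ne0$, whose corresponding points of $\mathbb{C}/\Lambda$ are $\omega_1/2$, $(\omega_1+\omega_2)/2$, $\omega_2/2$ for $i=1,2,3$ respectively. Let $a=\theta_2(0,\tau)$, $b=\theta_3(0,\tau)$, $c=\theta_4(0,\tau)$. Then $$\Delta_\phi=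\frac{2^{16}}{(\lambda_{11}\lambda_{22}-\lambda_{12}\lambda_{21})^{12}}\left(\frac{\pi}{\omega_1}\right)^{12}(abc)^8.$$
   Context: $\mathcal{P}(s)=s^{-2}+\sum_{\omega\in\Lambda\setminus\{0\}}\big((s+\omega)^{-2}-\omega^{-2}\big)$ is the Weierstrass function of $\Lambda$. Theta functions: $\theta_3(z,\tau)=\sum_{n\in\mathbb{Z}}\exp(\pi i n^2\tau+2\pi i nz)$, $\theta_2(z,\tau)=\exp(\pi i\tau/4+\pi iz)\theta_3(z+\tau/2,\tau)$, $\theta_4(z,\tau)=\theta_3(z+1/2,\tau)$. The discriminant is $\Delta_\phi=-\operatorname{Res}(\phi_x,\phi_y,\phi_z)/27$ with $\operatorname{Res}$ the multivariate resultant of three ternary quadratic forms normalized by $\operatorname{Res}(x^2,y^2,z^2)=1$. *)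

theory Defs
  imports "HOL-Analysis.Analysis" "HOL-Library.Poly_Mapping"
begin

text \<open>A monomial in variables of type 'v is its exponent function, and a polynomial is the
  finitely supported map from monomials to coefficients; the product of Poly_Mapping is then
  the usual product of polynomials.\<close>

type_synonym 'v monom = "'v \<Rightarrow>\<^sub>0 nat"
type_synonym 'v cpoly = "'v monom \<Rightarrow>\<^sub>0 complex"

definition mdeg :: "'v monom \<Rightarrow> nat" where
  "mdeg m = (\<Sum>v\<in>Poly_Mapping.keys m. Poly_Mapping.lookup m v)"

definition peval :: "'v cpoly \<Rightarrow> ('v \<Rightarrow> complex) \<Rightarrow> complex" where
  "peval p f = (\<Sum>m\<in>Poly_Mapping.keys p. Poly_Mapping.lookup p m *
     (\<Prod>v\<in>Poly_Mapping.keys m. f v ^ Poly_Mapping.lookup m v))"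

text \<open>The zero polynomial counts as a form of every degree.\<close>

definition is_form :: "nat \<Rightarrow> 'v cpoly \<Rightarrow> bool" where
  "is_form d p \<longleftrightarrow> (\<forall>m\<in>Poly_Mapping.keys p. mdeg m = d)"

text \<open>Partial derivative. If v does not occur in m, the factor
  \<open>lookup m v\<close> is zero, so the truncated exponent is irrelevant.\<close>

definition pdiff :: "'v \<Rightarrow> 'v cpoly \<Rightarrow> 'v cpoly" where
  "pdiff v p = (\<Sum>m\<in>Poly_Mapping.keys p.
     Poly_Mapping.single (m - Poly_Mapping.single v 1)
       (of_nat (Poly_Mapping.lookup m v) * Poly_Mapping.lookup p m))"

text \<open>Ternary polynomials have variables indexed by the type 3; the variables x, y, z are the
  indices 1, 2, 3 (where 3 = 0 in this type), matching the components of
  \<open>vector [x, y, z]\<close>.\<close>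

definition teval :: "3 cpoly \<Rightarrow> complex ^ 3 \<Rightarrow> complex" where
  "teval p v = peval p (\<lambda>i. v $ i)"

definition nonsingular_form :: "3 cpoly \<Rightarrow> bool" where
  "nonsingular_form \<phi> \<longleftrightarrow>
     (\<forall>v. v \<noteq> 0 \<and> teval \<phi> v = 0 \<longrightarrow> (\<exists>i. teval (pdiff i \<phi>) v \<noteq> 0))"

definition same_point :: "complex ^ 3 \<Rightarrow> complex ^ 3 \<Rightarrow> bool" where
  "same_point u v \<longleftrightarrow> u \<noteq> 0 \<and> v \<noteq> 0 \<and> (\<exists>c. c \<noteq> 0 \<and> u = c *s v)"

text \<open>A polynomial in the coefficients of three ternary forms has the variables \<open>(i, m)\<close>,
  standing for the coefficient of the monomial m in the i-th form.\<close>

type_synonym coeff_poly = "(3 \<times> 3 monom) cpoly"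

definition coeff_eval :: "coeff_poly \<Rightarrow> (3 \<Rightarrow> 3 cpoly) \<Rightarrow> complex" where
  "coeff_eval R F = peval R (\<lambda>(i, m). Poly_Mapping.lookup (F i) m)"

text \<open>The multivariate resultant of three ternary quadratic forms: the irreducible polynomial in
  their 18 coefficients, homogeneous of degree \<open>2 * 2\<close> in the coefficients of each form, that
  vanishes exactly when the forms have a common zero in the projective plane, normalized to be 1
  at \<open>(x^2, y^2, z^2)\<close>. These conditions determine it uniquely. The first one says that
  only coefficients of quadratic monomials occur.\<close>

definition quadrics_resultant :: "coeff_poly \<Rightarrow> bool" where
  "quadrics_resultant R \<longleftrightarrow>
     (\<forall>t\<in>Poly_Mapping.keys R. \<forall>(i, m)\<in>Poly_Mapping.keys t. mdeg m = 2) \<and>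
     (\<forall>t\<in>Poly_Mapping.keys R. \<forall>i.
        (\<Sum>w\<in>{w \<in> Poly_Mapping.keys t. fst w = i}. Poly_Mapping.lookup t w) = 4) \<and>
     irreducible R \<and>
     (\<forall>F. (\<forall>i. is_form 2 (F i)) \<longrightarrow>
        (coeff_eval R F = 0 \<longleftrightarrow> (\<exists>v. v \<noteq> 0 \<and> (\<forall>i. teval (F i) v = 0)))) \<and>
     coeff_eval R (\<lambda>i. Poly_Mapping.single (Poly_Mapping.single i 2) 1) = 1"

definition cubic_discriminant :: "coeff_poly \<Rightarrow> 3 cpoly \<Rightarrow> complex" where
  "cubic_discriminant R \<phi> = - coeff_eval R (\<lambda>i. pdiff i \<phi>) / 27"

definition lattice :: "complex \<Rightarrow> complex \<Rightarrow> complex set" where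
  "lattice \<omega>\<^sub>1 \<omega>\<^sub>2 = {of_int m * \<omega>\<^sub>1 + of_int n * \<omega>\<^sub>2 | m n. True}"

definition weierstrass_P :: "complex set \<Rightarrow> complex \<Rightarrow> complex" where
  "weierstrass_P \<Lambda> s =
     1 / s ^ 2 + (\<Sum>\<^sub>\<infinity>\<omega>\<in>\<Lambda> - {0}. 1 / (s + \<omega>) ^ 2 - 1 / \<omega> ^ 2)"

definition inv_g2 :: "complex set \<Rightarrow> complex" where
  "inv_g2 \<Lambda> = 60 * (\<Sum>\<^sub>\<infinity>\<omega>\<in>\<Lambda> - {0}. 1 / \<omega> ^ 4)"

definition inv_g3 :: "complex set \<Rightarrow> complex" where
  "inv_g3 \<Lambda> = 140 * (\<Sum>\<^sub>\<infinity>\<omega>\<in>\<Lambda> - {0}. 1 / \<omega> ^ 6)"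

definition theta3 :: "complex \<Rightarrow> complex \<Rightarrow> complex" where
  "theta3 z \<tau> = (\<Sum>\<^sub>\<infinity>n\<in>(UNIV :: int set).
     exp (complex_of_real pi * \<i> * of_int n ^ 2 * \<tau> + 2 * complex_of_real pi * \<i> * of_int n * z))"

definition theta2 :: "complex \<Rightarrow> complex \<Rightarrow> complex" where
  "theta2 z \<tau> = exp (complex_of_real pi * \<i> * \<tau> / 4 + complex_of_real pi * \<i> * z)
     * theta3 (z + \<tau> / 2) \<tau>"

definition theta4 :: "complex \<Rightarrow> complex \<Rightarrow> complex" where
  "theta4 z \<tau> = theta3 (z + 1 / 2) \<tau>"

end

theory Submission
  imports Defs
    "HOL-Complex_Analysis.Complex_Analysis"
    "HOL-Computational_Algebra.Fundamental_Theorem_Algebra"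
    "HOL-Library.Nat_Bijection"
begin

text \<open>
  For a nonsingular cubic, the resultant of the partial derivatives is a polynomial without zeros along
  every one-parameter group of transvections, hence constant by the fundamental theorem of
  algebra; together with homogeneity this makes it a covariant of weight \<open>12\<close> under linear
  substitutions. On the family \<open>-y\<^sup>2z + 4x\<^sup>3 - g\<^sub>2xz\<^sup>2 - g\<^sub>3z\<^sup>3\<close> weighted homogeneity and the
  vanishing at a nodal cubic force it to be a multiple of \<open>g\<^sub>2\<^sup>3 - 27g\<^sub>3\<^sup>2\<close>, and the constant is
  read off from the Fermat cubic, whose partial derivatives are \<open>3x\<^sup>2, 3y\<^sup>2, 3z\<^sup>2\<close>.

  The half-period points lie on the curve, so the three values of the Weierstrass function are the
  roots of \<open>4X\<^sup>3 - g\<^sub>2X - g\<^sub>3\<close>. Liouville's theorem expresses their differences through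
  the infinite products \<open>(x; q)\<^sub>\<infinity>\<close>, and the Jacobi triple product identifies these with the
  theta constants.
\<close>

section \<open>Polynomial functions\<close>

text \<open>The obstacle is that the resultant is known only through its degrees, its zero locus and
  one value; it is never expanded in its 18 coefficients. The weight 12 is 3 * 4: degree 4 in each
  of three partial derivatives, hence degree 12 in the cubic. A scalar matrix s multiplies a cubic
  by s^3, which is its determinant, and this turns degree 12 into det^12.

  Origin of the constants: the Fermat cubic has resultant 3^12, and writing -y^2 z - z^3 as a sum of
  two cubes converts this to 2^12 * 3^6 at g2 = 0, g3 = 1. After division by -27 a Weierstrass cubic
  has discriminant 2^12 (g2^3 - 27 g3^2), and the squared product of root differences brings another
  16.

  On the analytic side let q = exp(pi i \<tau>) and E = (q^2; q^2). Then abc = 2 q^(1/4) E^3, and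
  the squared product of root differences is (pi / \<open>\<omega>\<^sub>1\<close>)^12 * 2^8 q^2
  E^24. The exponent 8 is the one that makes the two match.\<close>

no_notation fps_nth (infixl "$" 75)

abbreviation "lookup \<equiv> Poly_Mapping.lookup"
abbreviation "keys \<equiv> Poly_Mapping.keys"
abbreviation "single \<equiv> Poly_Mapping.single"

text \<open>Polynomial dependence is recorded for functions because the resultant along a path of
  cubic forms arises by composition: closure properties are available where coefficients are
  not.\<close>

definition polyfun :: "(complex \<Rightarrow> complex) \<Rightarrow> bool" where
  "polyfun f \<longleftrightarrow> (\<exists>p. \<forall>t. f t = poly p t)"

lemma polyfun_const [intro, simp]: "polyfun (\<lambda>t. k)"
  unfolding polyfun_def by (rule exI[of _ "[:k:]"]) simp

lemma polyfun_id [intro, simp]: "polyfun (\<lambda>t. t)"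
  unfolding polyfun_def by (rule exI[of _ "[:0, 1:]"]) simp

lemma polyfun_add [intro]:
  assumes "polyfun f" "polyfun g"
  shows "polyfun (\<lambda>t. f t + g t)"
proof -
  obtain p q where "\<And>t. f t = poly p t" "\<And>t. g t = poly q t"
    using assms unfolding polyfun_def by blast
  then have "\<forall>t. f t + g t = poly (p + q) t" by simp
  then show ?thesis unfolding polyfun_def by blast
qed

lemma polyfun_mult [intro]:
  assumes "polyfun f" "polyfun g"
  shows "polyfun (\<lambda>t. f t * g t)"
proof -
  obtain p q where "\<And>t. f t = poly p t" "\<And>t. g t = poly q t"
    using assms unfolding polyfun_def by blast
  then have "\<forall>t. f t * g t = poly (p * q) t" by simp
  then show ?thesis unfolding polyfun_def by blast
qed

lemma polyfun_power [intro]: "polyfun f \<Longrightarrow> polyfun (\<lambda>t. f t ^ n)"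
  by (induction n) (simp_all add: polyfun_mult)

lemma polyfun_sum [intro]: "(\<And>i. i \<in> A \<Longrightarrow> polyfun (f i)) \<Longrightarrow> polyfun (\<lambda>t. \<Sum>i\<in>A. f i t)"
  by (induction A rule: infinite_finite_induct) (simp_all add: polyfun_add)

lemma polyfun_prod [intro]: "(\<And>i. i \<in> A \<Longrightarrow> polyfun (f i)) \<Longrightarrow> polyfun (\<lambda>t. \<Prod>i\<in>A. f i t)"
  by (induction A rule: infinite_finite_induct) (simp_all add: polyfun_mult)

text \<open>A nonconstant complex polynomial has a root. This rigidity stands in for explicit
  computation with the resultant.\<close>

lemma polyfun_nonzero_imp_const:
  assumes "polyfun f" "\<And>t. f t \<noteq> 0"
  shows "f s = f t"
proof -
  obtain p where p: "\<And>t. f t = poly p t" using assms(1) unfolding polyfun_def by auto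
  then have "\<And>t. poly p t \<noteq> 0" using assms(2) by auto
  then have "constant (poly p)"
    using Fundamental_Theorem_Algebra.fundamental_theorem_of_algebra[of p] by metis
  then show ?thesis using p by (simp add: constant_def)
qed

section \<open>Ternary cubic forms\<close>

lemma peval_superset:
  assumes "finite A" "keys p \<subseteq> A"
  shows "peval p f = (\<Sum>m\<in>A. lookup p m * (\<Prod>v\<in>keys m. f v ^ lookup m v))"
  unfolding peval_def using assms
  by (intro sum.mono_neutral_left) (auto simp: in_keys_iff)

lemma peval_zero [simp]: "peval 0 f = 0"
  by (simp add: peval_def)

lemma peval_add: "peval (p + q) f = peval p f + peval q f"
proof -
  let ?A = "keys p \<union> keys q"
  have "keys (p + q) \<subseteq> ?A" by (rule keys_add)
  then show ?thesis
    by (simp add: peval_superset[of ?A] lookup_add sum.distrib algebra_simps)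
qed

lemma peval_sum: "peval (sum p A) f = (\<Sum>i\<in>A. peval (p i) f)"
  by (induction A rule: infinite_finite_induct) (auto simp: peval_add)

lemma monom_eval_finite:
  fixes f :: "'v::finite \<Rightarrow> complex"
  shows "(\<Prod>v\<in>keys m. f v ^ lookup m v) = (\<Prod>v\<in>UNIV. f v ^ lookup m v)"
  by (intro prod.mono_neutral_left) (auto simp: in_keys_iff)

lemma peval_single:
  fixes f :: "'v::finite \<Rightarrow> complex"
  shows "peval (single m x) f = x * (\<Prod>v\<in>UNIV. f v ^ lookup m v)"
  by (cases "x = 0") (auto simp: peval_def monom_eval_finite)

text \<open>Distinct monomials divisible by \<open>v\<close> have distinct quotients, so each
  coefficient comes from a single monomial of \<open>p\<close>. A monomial without \<open>v\<close>
  is unchanged by the truncated subtraction and could collide with \<open>m\<close>, but then its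
  factor is 0.\<close>

lemma lookup_pdiff:
  "lookup (pdiff v p) m = of_nat (lookup m v + 1) * lookup p (m + single v 1)"
proof -
  let ?k = "m + single v 1"
  have *: "lookup (single (n - single v 1) (of_nat (lookup n v) * lookup p n)) m =
        (if n = ?k then of_nat (lookup m v + 1) * lookup p ?k else 0)" for n
  proof (cases "lookup n v = 0")
    case True
    then have "n \<noteq> ?k" by (auto simp: lookup_add)
    then show ?thesis using True by simp
  next
    case False
    then have "n = (n - single v 1) + single v 1"
      by (intro poly_mapping_eqI) (auto simp: lookup_add lookup_minus lookup_single when_def)
    then have "n - single v 1 = m \<longleftrightarrow> n = ?k" by (metis add_diff_cancel_right')
    then show ?thesis by (auto simp: lookup_single when_def lookup_add)
  qed
  show ?thesis
    unfolding pdiff_def lookup_sum * sum.delta[OF finite_keys]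
    by (auto simp: in_keys_iff simp del: of_nat_add)
qed

lemma pdiff_add: "pdiff v (p + q) = pdiff v p + pdiff v q"
  by (intro poly_mapping_eqI) (simp add: lookup_pdiff lookup_add algebra_simps)

lemma pdiff_zero [simp]: "pdiff v 0 = 0"
  by (intro poly_mapping_eqI) (simp add: lookup_pdiff)

lemma pdiff_sum: "pdiff v (sum p A) = (\<Sum>i\<in>A. pdiff v (p i))"
  by (induction A rule: infinite_finite_induct) (auto simp: pdiff_add)

lemma pdiff_single:
  "pdiff v (single m x) = single (m - single v 1) (of_nat (lookup m v) * x)"
  by (cases "x = 0") (auto simp: pdiff_def)

section \<open>Cubic forms as tensors, and linear substitutions\<close>

type_synonym tensor3 = "3 \<Rightarrow> 3 \<Rightarrow> 3 \<Rightarrow> complex"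

definition mon3 :: "3 \<Rightarrow> 3 \<Rightarrow> 3 \<Rightarrow> 3 monom" where
  "mon3 i j k = single i 1 + single j 1 + single k 1"

text \<open>The tensor need not be symmetric, so many tensors give one form. This spares multinomial
  coefficients in every substitution; \<open>disc3_cong\<close> removes the ambiguity later.\<close>

definition cubic_form :: "tensor3 \<Rightarrow> 3 cpoly" where
  "cubic_form c = (\<Sum>i\<in>UNIV. \<Sum>j\<in>UNIV. \<Sum>k\<in>UNIV. single (mon3 i j k) (c i j k))"

definition trilin :: "tensor3 \<Rightarrow> complex^3 \<Rightarrow> complex^3 \<Rightarrow> complex^3 \<Rightarrow> complex" where
  "trilin c u v w = (\<Sum>i\<in>UNIV. \<Sum>j\<in>UNIV. \<Sum>k\<in>UNIV. c i j k * u $ i * v $ j * w $ k)"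

text \<open>The derivative of \<open>\<lambda>v. trilin c v v v\<close> in direction
  \<open>w\<close>; the three slots contribute separately since \<open>c\<close> is not assumed
  symmetric.\<close>

definition cubic_deriv :: "tensor3 \<Rightarrow> complex^3 \<Rightarrow> complex^3 \<Rightarrow> complex" where
  "cubic_deriv c v w = trilin c w v v + trilin c v w v + trilin c v v w"

lemma monom_eval_single: 
  fixes f :: "'v::finite \<Rightarrow> complex"
  shows "(\<Prod>v\<in>UNIV. f v ^ lookup (single i 1 :: 'v monom) v) = f i"
proof -
  have "(\<Prod>v\<in>UNIV. f v ^ lookup (single i 1 :: 'v monom) v) = (\<Prod>v\<in>UNIV. if v = i then f v else 1)"
    by (intro prod.cong) (auto simp: lookup_single when_def)
  then show ?thesis by simp
qed

lemma monom_eval_add: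
  fixes f :: "'v::finite \<Rightarrow> complex"
  shows "(\<Prod>v\<in>UNIV. f v ^ lookup (m + n) v) = (\<Prod>v\<in>UNIV. f v ^ lookup m v) * (\<Prod>v\<in>UNIV. f v ^ lookup n v)"
  by (simp add: lookup_add power_add prod.distrib)

lemma teval_single2: "teval (single (single i 1 + single j 1) x) v = x * v $ i * v $ j"
  unfolding teval_def peval_single monom_eval_add monom_eval_single by simp

lemma teval_mon3: "teval (single (mon3 i j k) x) v = x * v $ i * v $ j * v $ k"
  unfolding teval_def mon3_def peval_single monom_eval_add monom_eval_single by simp

lemma teval_add: "teval (p + q) v = teval p v + teval q v"
  by (simp add: teval_def peval_add)

lemma teval_sum: "teval (sum p A) v = (\<Sum>i\<in>A. teval (p i) v)"
  by (simp add: teval_def peval_sum)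

lemma teval_cubic_form: "teval (cubic_form c) v = trilin c v v v"
  by (simp add: cubic_form_def trilin_def teval_sum teval_mon3)

lemma pdiff_mon3:
  "pdiff a (single (mon3 i j k) x) =
     single (single j 1 + single k 1) (if i = a then x else 0) +
     single (single i 1 + single k 1) (if j = a then x else 0) +
     single (single i 1 + single j 1) (if k = a then x else 0)"
proof -
  have 1: "lookup (mon3 i j k) a = (if i = a then 1 else 0) + (if j = a then 1 else 0) + (if k = a then 1 else 0)"
    by (simp add: mon3_def lookup_add lookup_single when_def)
  have 2: "mon3 i j k - single i 1 = single j 1 + single k 1"
    "mon3 i j k - single j 1 = single i 1 + single k 1"
    "mon3 i j k - single k 1 = single i 1 + single j 1"
    unfolding mon3_def
    by (intro poly_mapping_eqI; simp add: lookup_add lookup_minus)+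
  have 3: "single (mon3 i j k - single a 1) (of_nat (if l = a then 1 else 0) * x) = single n (if l = a then x else 0)"
    if "mon3 i j k - single l 1 = n" for l n
    using that by (cases "l = a") auto
  show ?thesis
    unfolding pdiff_single 1 of_nat_add distrib_right single_add
    by (simp only: 3[OF 2(1)] 3[OF 2(2)] 3[OF 2(3)])
qed

lemma trilin_axis:
  "trilin c (axis a 1) u v = (\<Sum>j\<in>UNIV. \<Sum>k\<in>UNIV. c a j k * u $ j * v $ k)"
  "trilin c u (axis a 1) v = (\<Sum>i\<in>UNIV. \<Sum>k\<in>UNIV. c i a k * u $ i * v $ k)"
  "trilin c u v (axis a 1) = (\<Sum>i\<in>UNIV. \<Sum>j\<in>UNIV. c i j a * u $ i * v $ j)"
  using exhaust_3[of a] by (auto simp: trilin_def axis_def sum_3)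

lemma teval_pdiff_cubic_form: "teval (pdiff a (cubic_form c)) v = cubic_deriv c v (axis a 1)"
  unfolding cubic_form_def cubic_deriv_def pdiff_sum pdiff_mon3 teval_sum teval_add teval_single2 trilin_axis
  using exhaust_3[of a] by (auto simp: sum_3)

definition subst3 :: "tensor3 \<Rightarrow> complex^3^3 \<Rightarrow> tensor3" where
  "subst3 c M = (\<lambda>a b d. trilin c (column a M) (column b M) (column d M))"

lemma trilin_add:
  "trilin c (u + u') v w = trilin c u v w + trilin c u' v w"
  "trilin c u (v + v') w = trilin c u v w + trilin c u v' w"
  "trilin c u v (w + w') = trilin c u v w + trilin c u v w'"
  by (simp_all add: trilin_def sum.distrib[symmetric] algebra_simps)

lemma trilin_smult:
  "trilin c (s *s u) v w = s * trilin c u v w"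
  "trilin c u (s *s v) w = s * trilin c u v w"
  "trilin c u v (s *s w) = s * trilin c u v w"
  by (simp_all add: trilin_def sum_distrib_left algebra_simps)

lemma trilin_zero [simp]: "trilin c 0 v w = 0" "trilin c u 0 w = 0" "trilin c u v 0 = 0"
  by (simp_all add: trilin_def)

lemma trilin_sum:
  "trilin c (\<Sum>i\<in>A. f i) v w = (\<Sum>i\<in>A. trilin c (f i) v w)"
  "trilin c u (\<Sum>i\<in>A. f i) w = (\<Sum>i\<in>A. trilin c u (f i) w)"
  "trilin c u v (\<Sum>i\<in>A. f i) = (\<Sum>i\<in>A. trilin c u v (f i))"
  by (induction A rule: infinite_finite_induct; simp add: trilin_add)+

lemma mult_vec_columns: "M *v v = (\<Sum>i\<in>UNIV. v $ i *s column i M)"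
  for M :: "complex^3^3"
  by (simp add: matrix_mult_sum)

lemma trilin_subst3: "trilin (subst3 c M) u v w = trilin c (M *v u) (M *v v) (M *v w)"
  unfolding mult_vec_columns trilin_sum(1) trilin_smult(1)
  unfolding trilin_sum(2) trilin_smult(2)
  unfolding trilin_sum(3) trilin_smult(3)
  unfolding trilin_def[of "subst3 c M"]
  by (simp add: subst3_def sum_distrib_left mult_ac)

lemma cubic_deriv_subst3: "cubic_deriv (subst3 c M) v w = cubic_deriv c (M *v v) (M *v w)"
  by (simp add: cubic_deriv_def trilin_subst3)

lemma cubic_deriv_axis: "cubic_deriv c v w = (\<Sum>i\<in>UNIV. w $ i * cubic_deriv c v (axis i 1))"
proof -
  have "w = (\<Sum>i\<in>UNIV. w $ i *s axis i 1)"
    by (simp add: basis_expansion)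
  then have "cubic_deriv c v w = cubic_deriv c v (\<Sum>i\<in>UNIV. w $ i *s axis i 1)" by simp
  also have "\<dots> = (\<Sum>i\<in>UNIV. w $ i * cubic_deriv c v (axis i 1))"
    unfolding cubic_deriv_def trilin_sum trilin_smult
    by (simp add: sum.distrib[symmetric] algebra_simps)
  finally show ?thesis .
qed

text \<open>Using all directions instead of coordinate ones makes invariance under invertible
  matrices immediate. By Euler's relation (take \<open>w = v\<close>) such a \<open>v\<close> also
  lies on the curve.\<close>

definition singular3 :: "tensor3 \<Rightarrow> bool" where
  "singular3 c \<longleftrightarrow> (\<exists>v. v \<noteq> 0 \<and> (\<forall>w. cubic_deriv c v w = 0))"

lemma singular3_iff: "singular3 c \<longleftrightarrow> (\<exists>v. v \<noteq> 0 \<and> (\<forall>i. teval (pdiff i (cubic_form c)) v = 0))"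
  unfolding singular3_def teval_pdiff_cubic_form
  by (metis (no_types, lifting) cubic_deriv_axis mult_zero_right sum.neutral)

lemma singular3_subst3:
  assumes "M ** N = mat 1" "N ** M = mat 1"
  shows "singular3 (subst3 c M) \<longleftrightarrow> singular3 c"
proof -
  have MN: "M *v (N *v v) = v" "N *v (M *v v) = v" for v
    using assms by (simp_all add: matrix_vector_mul_assoc)
  show ?thesis
  proof
    assume "singular3 (subst3 c M)"
    then obtain v where v: "v \<noteq> 0" "\<And>w. cubic_deriv c (M *v v) (M *v w) = 0"
      unfolding singular3_def cubic_deriv_subst3 by auto
    have "M *v v \<noteq> 0" using v(1) MN(2)[of v] by auto
    moreover have "cubic_deriv c (M *v v) w = 0" for w using v(2)[of "N *v w"] MN by simp
    ultimately show "singular3 c" unfolding singular3_def by blast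
  next
    assume "singular3 c"
    then obtain v where v: "v \<noteq> 0" "\<And>w. cubic_deriv c v w = 0" unfolding singular3_def by auto
    have "N *v v \<noteq> 0" using v(1) MN(1)[of v] by auto
    moreover have "cubic_deriv (subst3 c M) (N *v v) w = 0" for w
      using v(2) MN by (simp add: cubic_deriv_subst3)
    ultimately show "singular3 (subst3 c M)" unfolding singular3_def by blast
  qed
qed

section \<open>The resultant of the partial derivatives as a function of the tensor\<close>

definition disc3 :: "coeff_poly \<Rightarrow> tensor3 \<Rightarrow> complex" where
  "disc3 R c = coeff_eval R (\<lambda>i. pdiff i (cubic_form c))"

lemma lookup_cubic_form:
  "lookup (cubic_form c) m = (\<Sum>i\<in>UNIV. \<Sum>j\<in>UNIV. \<Sum>k\<in>UNIV. (if mon3 i j k = m then c i j k else 0))"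
  by (simp add: cubic_form_def lookup_sum lookup_single when_def)

lemma polyfun_if: "polyfun f \<Longrightarrow> polyfun g \<Longrightarrow> polyfun (\<lambda>t. if b then f t else g t)"
  by (cases b) simp_all

lemma polyfun_coeff_eval:
  assumes "\<And>i m. polyfun (\<lambda>t. lookup (F t i) m)"
  shows "polyfun (\<lambda>t. coeff_eval R (F t))"
  unfolding coeff_eval_def peval_def
  by (intro polyfun_sum polyfun_mult polyfun_const polyfun_prod polyfun_power)
    (auto simp: case_prod_beta assms)

lemma polyfun_disc3:
  assumes "\<And>i j k. polyfun (\<lambda>t. c t i j k)"
  shows "polyfun (\<lambda>t. disc3 R (c t))"
  unfolding disc3_def
  by (intro polyfun_coeff_eval)
    (auto simp: lookup_pdiff lookup_cubic_form intro!: polyfun_mult polyfun_sum polyfun_if assms)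

lemma polyfun_subst3:
  assumes "\<And>i j. polyfun (\<lambda>t. M t $ i $ j)"
  shows "polyfun (\<lambda>t. subst3 c (M t) i j k)"
  unfolding subst3_def trilin_def column_def
  by (auto intro!: polyfun_sum polyfun_mult assms)

lemma mdeg_eq: "mdeg m = (\<Sum>v\<in>UNIV. lookup m v)" for m :: "3 monom"
  unfolding mdeg_def by (intro sum.mono_neutral_left) (auto simp: in_keys_iff)

lemma mdeg_add: "mdeg (m + n) = mdeg m + mdeg n" for m n :: "3 monom"
  by (simp add: mdeg_eq lookup_add sum.distrib)

lemma mdeg_single [simp]: "mdeg (single i n) = n" for i :: 3
  by (simp add: mdeg_eq lookup_single when_def)

lemma mdeg_mon3 [simp]: "mdeg (mon3 i j k) = 3"
  by (simp add: mon3_def mdeg_add)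

lemma is_form_cubic_form: "is_form 3 (cubic_form c)"
proof -
  have "mdeg m = 3" if "lookup (cubic_form c) m \<noteq> 0" for m
  proof (rule ccontr)
    assume "mdeg m \<noteq> 3"
    then have "mon3 i j k \<noteq> m" for i j k by auto
    then show False using that by (simp add: lookup_cubic_form)
  qed
  then show ?thesis by (simp add: is_form_def in_keys_iff)
qed

lemma is_form_pdiff:
  fixes p :: "3 cpoly"
  assumes "is_form (Suc d) p"
  shows "is_form d (pdiff i p)"
proof -
  have "mdeg m = d" if "lookup (pdiff i p) m \<noteq> 0" for m
  proof -
    have "lookup p (m + single i 1) \<noteq> 0" using that by (auto simp: lookup_pdiff)
    then have "mdeg (m + single i 1) = Suc d" using assms by (auto simp: is_form_def in_keys_iff)
    then show ?thesis by (simp add: mdeg_add)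
  qed
  then show ?thesis by (simp add: is_form_def in_keys_iff)
qed

locale quadrics_res =
  fixes R :: coeff_poly
  assumes R: "quadrics_resultant R"
begin


lemma resultant_eq_0_iff:
  assumes "\<And>i. is_form 2 (F i)"
  shows "coeff_eval R F = 0 \<longleftrightarrow> (\<exists>v. v \<noteq> 0 \<and> (\<forall>i. teval (F i) v = 0))"
proof -
  have "\<forall>F. (\<forall>i. is_form 2 (F i)) \<longrightarrow>
        (coeff_eval R F = 0 \<longleftrightarrow> (\<exists>v. v \<noteq> 0 \<and> (\<forall>i. teval (F i) v = 0)))"
    using R unfolding quadrics_resultant_def by (elim conjE)
  then show ?thesis using assms by blast
qed

lemma disc3_eq_0_iff: "disc3 R c = 0 \<longleftrightarrow> singular3 c"
proof -
  have "is_form 2 (pdiff i (cubic_form c))" for i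
    using is_form_pdiff[of 2] is_form_cubic_form by (simp add: numeral_3_eq_3)
  then show ?thesis
    unfolding disc3_def singular3_iff by (rule resultant_eq_0_iff)
qed

text \<open>Every monomial of \<open>R\<close> has degree 4 in the coefficients of each of the three
  forms, hence total degree 12.\<close>

lemma coeff_eval_scale:
  assumes "\<And>i m. lookup (F i) m = s * lookup (G i) m"
  shows "coeff_eval R F = s ^ 12 * coeff_eval R G"
proof -
  have deg: "(\<Sum>w\<in>keys t. lookup t w) = 12" if "t \<in> keys R" for t
  proof -
    have 4: "(\<Sum>w\<in>{w \<in> keys t. fst w = i}. lookup t w) = 4" for i
      using R that unfolding quadrics_resultant_def by blast
    have "(\<Sum>w\<in>keys t. lookup t w) = (\<Sum>i\<in>UNIV. \<Sum>w\<in>{w \<in> keys t. fst w = i}. lookup t w)"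
      by (rule sum.group[symmetric]) auto
    then show ?thesis unfolding 4 by simp
  qed
  have "(\<Prod>v\<in>keys t. (case v of (i, m) \<Rightarrow> lookup (F i) m) ^ lookup t v) =
      s ^ 12 * (\<Prod>v\<in>keys t. (case v of (i, m) \<Rightarrow> lookup (G i) m) ^ lookup t v)" if "t \<in> keys R" for t
    unfolding deg[OF that, symmetric] power_sum prod.distrib[symmetric]
    by (simp add: assms case_prod_beta power_mult_distrib)
  then show ?thesis
    unfolding coeff_eval_def peval_def by (simp add: sum_distrib_left algebra_simps)
qed

lemma disc3_scale: "disc3 R (\<lambda>i j k. s * c i j k) = s ^ 12 * disc3 R c"
  unfolding disc3_def
  by (rule coeff_eval_scale)
    (simp add: lookup_pdiff lookup_cubic_form sum_distrib_left if_distrib[of "\<lambda>x. _ * x"] mult.left_commute cong: if_cong)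

end

section \<open>Covariance of the discriminant\<close>

text \<open>Kronecker substitution: on the curve (t, t^4, 1) the monomial with exponents (i, j, k)
  becomes t^(i + 4j). In degree 3 both i and j are at most 3, so they are the base-4 digits of the
  new exponent, and k = 3 - i - j.\<close>

lemma form3_eqI:
  fixes p q :: "3 cpoly"
  assumes "is_form 3 p" "is_form 3 q" "\<And>t. teval p (vector [t, t ^ 4, 1]) = teval q (vector [t, t ^ 4, 1])"
  shows "p = q"
proof (rule poly_mapping_eqI)
  fix m0
  define A where "A = keys p \<union> keys q"
  define e where "e = (\<lambda>m :: 3 monom. lookup m 1 + 4 * lookup m 2)"
  have fin: "finite A" by (simp add: A_def)
  have deg: "lookup m 1 + lookup m 2 + lookup m 3 = 3" if "m \<in> A" for m
    using that assms(1,2) by (auto simp: A_def is_form_def mdeg_eq sum_3)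
  have inj: "m = n" if "m \<in> A" "n \<in> A" "e m = e n" for m n
  proof -
    have "lookup m 1 = lookup n 1 \<and> lookup m 2 = lookup n 2 \<and> lookup m 3 = lookup n 3"
      using deg[OF that(1)] deg[OF that(2)] that(3) unfolding e_def
      by (cases rule: linorder_cases[of "lookup m 2" "lookup n 2"]) linarith+
    then have "\<forall>v. lookup m v = lookup n v" by (simp add: forall_3)
    then show ?thesis by (intro poly_mapping_eqI) simp
  qed
  have ev: "teval f (vector [t, t ^ 4, 1]) = (\<Sum>m\<in>A. lookup f m * t ^ e m)"
    if "keys f \<subseteq> A" for f t
  proof -
    have "(\<Prod>v\<in>UNIV. (vector [t, t ^ 4, 1] :: complex^3) $ v ^ lookup m v) = t ^ e m" for m
    proof -
      have "(\<Prod>v\<in>UNIV. (vector [t, t ^ 4, 1] :: complex^3) $ v ^ lookup m v) = t ^ lookup m 1 * (t ^ 4) ^ lookup m 2"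
        unfolding UNIV_3 by simp
      then show ?thesis by (simp only: e_def power_add power_mult)
    qed
    then show ?thesis
      by (simp only: teval_def peval_superset[OF fin that] monom_eval_finite)
  qed
  define P where "P = (\<Sum>m\<in>A. monom (lookup p m - lookup q m) (e m))"
  have "poly P t = 0" for t
    using assms(3)[of t] ev[of p t] ev[of q t]
    by (simp add: P_def poly_sum poly_monom A_def sum_subtractf algebra_simps)
  then have "P = 0" by (simp add: poly_all_0_iff_0[symmetric])
  show "lookup p m0 = lookup q m0"
  proof (cases "m0 \<in> A")
    case True
    have "0 = coeff P (e m0)" using \<open>P = 0\<close> by simp
    also have "\<dots> = (\<Sum>m\<in>A. if e m = e m0 then lookup p m - lookup q m else 0)"
      by (simp add: P_def coeff_sum)
    also have "\<dots> = (\<Sum>m\<in>A. if m = m0 then lookup p m - lookup q m else 0)"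
      using inj[OF _ True] by (intro sum.cong) auto
    also have "\<dots> = lookup p m0 - lookup q m0" using True fin by simp
    finally show ?thesis by simp
  qed (auto simp: A_def in_keys_iff)
qed

text \<open>Each coefficient is shared equally among the ordered triples that produce its monomial;
  \<open>N m\<close> counts these triples.\<close>

lemma form3_tensor_exists:
  assumes "is_form 3 \<phi>"
  obtains c where "\<phi> = cubic_form c"
proof -
  define N where "N = (\<lambda>m. \<Sum>i\<in>UNIV. \<Sum>j\<in>UNIV. \<Sum>k\<in>UNIV. (if mon3 i j k = m then 1 else 0 :: complex))"
  have Nn: "N m = of_nat (card {(i, j, k). mon3 i j k = m})" for m
  proof -
    have "N m = (\<Sum>x\<in>UNIV \<times> UNIV \<times> UNIV. (if x \<in> {(i, j, k). mon3 i j k = m} then 1 else 0))"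
      unfolding N_def sum.cartesian_product by (intro sum.cong) auto
    then show ?thesis by (simp add: sum.If_cases)
  qed
  have N0: "N (mon3 i j k) \<noteq> 0" for i j k
    unfolding Nn of_nat_eq_0_iff by (subst card_0_eq) auto
  have mon: "\<exists>i j k. m = mon3 i j k" if m: "mdeg m = 3" for m
  proof -
    \<comment> \<open>A variable that occurs can be split off; three rounds present a cubic monomial
      by an ordered triple.\<close>
    have step: "\<exists>i n'. n = n' + single i 1 \<and> mdeg n' = d" if "mdeg n = Suc d" for n :: "3 monom" and d
    proof -
      have "\<exists>i. lookup n i \<noteq> 0" using that by (auto simp: mdeg_eq intro: ccontr)
      then obtain i where i: "lookup n i \<noteq> 0" by blast
      have n: "n = (n - single i 1) + single i 1"
        using i by (intro poly_mapping_eqI) (auto simp: lookup_add lookup_minus lookup_single when_def)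
      have "mdeg n = mdeg (n - single i 1) + 1" by (subst n) (simp add: mdeg_add)
      then show ?thesis using n that by (metis Suc_eq_plus1 add_right_cancel)
    qed
    obtain i m1 where 1: "m = m1 + single i 1" "mdeg m1 = 2" using step[of m 2] m by auto
    obtain j m2 where 2: "m1 = m2 + single j 1" "mdeg m2 = 1" using step[of m1 1] 1 by auto
    obtain k m3 where 3: "m2 = m3 + single k 1" "mdeg m3 = 0" using step[of m2 0] 2 by auto
    have "m3 = 0" using 3(2) by (intro poly_mapping_eqI) (simp add: mdeg_eq)
    then have "m = mon3 k j i" using 1 2 3 by (simp add: mon3_def)
    then show ?thesis by blast
  qed
  define c where "c = (\<lambda>i j k. lookup \<phi> (mon3 i j k) / N (mon3 i j k))"
  have "\<phi> = cubic_form c"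
  proof (rule poly_mapping_eqI)
    fix m
    have eq: "lookup (cubic_form c) m = lookup \<phi> m / N m * N m"
      unfolding lookup_cubic_form N_def[of ] sum_distrib_left c_def
      by (intro sum.cong refl) auto
    show "lookup \<phi> m = lookup (cubic_form c) m"
    proof (cases "mdeg m = 3")
      case True
      then show ?thesis using mon[OF True] N0 eq by auto
    next
      case False
      then have "lookup \<phi> m = 0" using assms by (auto simp: is_form_def in_keys_iff)
      then show ?thesis using eq by simp
    qed
  qed
  then show ?thesis by (rule that)
qed

section \<open>Elementary matrices in coordinates\<close>

definition transvec :: "3 \<Rightarrow> 3 \<Rightarrow> complex \<Rightarrow> complex^3^3" where
  "transvec p q t = (\<chi> i j. if i = j then 1 else if i = p \<and> j = q then t else 0)"

lemma column_mult: "column a (A ** B) = A *v column a B"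
  for A B :: "complex^3^3"
  by (simp add: vec_eq_iff column_def matrix_matrix_mult_def matrix_vector_mult_def)

lemma subst3_mult: "subst3 c (A ** B) = subst3 (subst3 c A) B"
  by (simp add: subst3_def[of _ "A ** B"] subst3_def[of _ B] column_mult trilin_subst3)

lemma subst3_mat: "subst3 c (mat s) = (\<lambda>i j k. s ^ 3 * c i j k)"
proof -
  have "column a (mat s) = s *s axis a 1" for a :: 3
    by (auto simp: vec_eq_iff column_def mat_def axis_def)
  moreover have "trilin c (axis i 1) (axis j 1) (axis k 1) = c i j k" for i j k
    using exhaust_3[of i] exhaust_3[of j] exhaust_3[of k] by (auto simp: trilin_def axis_def sum_3)
  ultimately show ?thesis
    by (simp add: subst3_def trilin_smult fun_eq_iff power3_eq_cube mult.assoc)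
qed

lemma transvec_0: "transvec p q 0 = mat 1"
  by (simp add: transvec_def mat_def vec_eq_iff)

lemma transvec_inverse: "p \<noteq> q \<Longrightarrow> transvec p q t ** transvec p q (-t) = mat 1"
  using exhaust_3[of p] exhaust_3[of q]
  by (auto simp: vec_eq_iff transvec_def mat_def matrix_matrix_mult_def sum_3 forall_3)

lemma det_transvec: "p \<noteq> q \<Longrightarrow> det (transvec p q t) = 1"
  using exhaust_3[of p] exhaust_3[of q]
  by (auto simp: det_3 transvec_def)

definition mat3 :: "'a \<Rightarrow> 'a \<Rightarrow> 'a \<Rightarrow> 'a \<Rightarrow> 'a \<Rightarrow> 'a \<Rightarrow> 'a \<Rightarrow> 'a \<Rightarrow> 'a::zero \<Rightarrow> 'a^3^3" where
  "mat3 a b c d e f g h i = vector [vector [a, b, c], vector [d, e, f], vector [g, h, i]]"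

lemma mat3_mult:
  "mat3 a b c d e f g h i ** mat3 a' b' c' d' e' f' g' h' i' =
    mat3 (a*a' + b*d' + c*g') (a*b' + b*e' + c*h') (a*c' + b*f' + c*i')
         (d*a' + e*d' + f*g') (d*b' + e*e' + f*h') (d*c' + e*f' + f*i')
         (g*a' + h*d' + i*g') (g*b' + h*e' + i*h') (g*c' + h*f' + i*i' :: complex)"
  by (simp add: vec_eq_iff mat3_def matrix_matrix_mult_def sum_3 forall_3)

lemma mat3_mult_vec:
  "mat3 a b c d e f g h i *v v = vector [a * v$1 + b * v$2 + c * v$3, 
    d * v$1 + e * v$2 + f * v$3, g * v$1 + h * v$2 + i * v$3 :: complex]"
  by (simp add: vec_eq_iff mat3_def matrix_vector_mult_def sum_3 forall_3)

lemma det_mat3: "det (mat3 a b c d e f g h i) = 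
  a*e*i + b*f*g + c*d*h - a*f*h - b*d*i - c*e*(g::complex)"
  by (simp add: det_3 mat3_def)

lemma transvec_mat3:
  "transvec 1 2 t = mat3 1 t 0 0 1 0 0 0 1" "transvec 1 3 t = mat3 1 0 t 0 1 0 0 0 1"
  "transvec 2 3 t = mat3 1 0 0 0 1 t 0 0 1" "transvec 2 1 t = mat3 1 0 0 t 1 0 0 0 1"
  "transvec 3 1 t = mat3 1 0 0 0 1 0 t 0 1" "transvec 3 2 t = mat3 1 0 0 0 1 0 0 t 1"
  by (simp_all add: vec_eq_iff transvec_def mat3_def forall_3)

lemma mat_mat3: "mat s = mat3 s 0 0 0 s 0 0 0 s"
  by (simp add: vec_eq_iff mat_def mat3_def forall_3)

context quadrics_res
begin

text \<open>Quantifying over all \<open>c\<close> makes the property multiplicative in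
  \<open>M\<close>, so that it can be checked on generators.\<close>

definition covariant :: "complex^3^3 \<Rightarrow> bool" where
  "covariant M \<longleftrightarrow> (\<forall>c. disc3 R (subst3 c M) = det M ^ 12 * disc3 R c)"

lemma covariant_mult: "covariant A \<Longrightarrow> covariant B \<Longrightarrow> covariant (A ** B)"
  by (simp add: covariant_def subst3_mult det_mul power_mult_distrib)

lemma covariant_mat: "covariant (mat s)"
proof -
  have "det (mat s :: complex^3^3) = s ^ 3"
    by (simp add: mat_mat3 det_mat3 power3_eq_cube)
  then show ?thesis
    by (simp add: covariant_def subst3_mat disc3_scale)
qed

text \<open>Transvections are invertible, so along the family the discriminant vanishes for every
  parameter or for none. In the second case it is a polynomial in \<open>t\<close> without zeros and
  equals its value at \<open>t = 0\<close>, where the matrix is the identity.\<close>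

lemma covariant_transvec:
  assumes "p \<noteq> q"
  shows "covariant (transvec p q t)"
proof -
  have zero_iff: "disc3 R (subst3 c (transvec p q t)) = 0 \<longleftrightarrow> disc3 R c = 0" for c t
  proof -
    have "transvec p q (- t) ** transvec p q t = mat 1"
      using transvec_inverse[OF assms, of "- t"] by simp
    then show ?thesis
      unfolding disc3_eq_0_iff
      by (intro singular3_subst3[OF transvec_inverse[OF assms]])
  qed
  have "disc3 R (subst3 c (transvec p q t)) = disc3 R c" for c
  proof (cases "disc3 R c = 0")
    case True
    then show ?thesis using zero_iff by metis
  next
    case False
    have "disc3 R (subst3 c (transvec p q t)) = disc3 R (subst3 c (transvec p q 0))"
    proof (rule polyfun_nonzero_imp_const[where f = "\<lambda>t. disc3 R (subst3 c (transvec p q t))"])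
      show "polyfun (\<lambda>t. disc3 R (subst3 c (transvec p q t)))"
        by (intro polyfun_disc3 polyfun_subst3) (auto simp: transvec_def intro!: polyfun_if)
      show "disc3 R (subst3 c (transvec p q t)) \<noteq> 0" for t
        using False zero_iff by metis
    qed
    then show ?thesis by (simp add: transvec_0 subst3_mat)
  qed
  then show ?thesis by (simp add: covariant_def det_transvec assms)
qed

lemma covariant_shears:
  "covariant (mat3 1 t 0 0 1 0 0 0 1)" "covariant (mat3 1 0 t 0 1 0 0 0 1)"
  "covariant (mat3 1 0 0 0 1 t 0 0 1)" "covariant (mat3 1 0 0 t 1 0 0 0 1)"
  "covariant (mat3 1 0 0 0 1 0 t 0 1)" "covariant (mat3 1 0 0 0 1 0 0 t 1)"
  by (simp_all add: transvec_mat3[symmetric] covariant_transvec)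

text \<open>A cube root \<open>s\<close> of the determinant splits off a scalar matrix. The
  remaining diagonal matrix of determinant 1 is a product of two blocks diag(x, 1/x), each generated
  by shears.\<close>

lemma covariant_diag:
  assumes "a \<noteq> 0" "b \<noteq> 0" "d \<noteq> 0"
  shows "covariant (mat3 a 0 0 0 b 0 0 0 d)"
proof -
  obtain s where s: "s ^ 3 = a * b * d"
    using exists_complex_root[of 3 "a * b * d"] by (metis numeral_neq_zero zero_neq_numeral)
  have s0: "s \<noteq> 0" using s assms by auto
  have 1: "covariant (mat3 x 0 0 0 (1/x) 0 0 0 1)" if "x \<noteq> 0" for x
  proof -
    \<comment> \<open>In the upper left block the first triple of shears is the matrix with rows (0,
      x) and (-1/x, 0), the second the one with rows (0, -1) and (1, 0).\<close>
    have "mat3 x 0 0 0 (1/x) 0 0 0 1 =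
      (mat3 1 x 0 0 1 0 0 0 1 ** mat3 1 0 0 (-1/x) 1 0 0 0 1 ** mat3 1 x 0 0 1 0 0 0 1) **
      (mat3 1 (-1) 0 0 1 0 0 0 1 ** mat3 1 0 0 1 1 0 0 0 1 ** mat3 1 (-1) 0 0 1 0 0 0 1)"
      using that by (simp add: mat3_mult)
    then show ?thesis by (simp add: covariant_mult covariant_shears)
  qed
  have 2: "covariant (mat3 1 0 0 0 x 0 0 0 (1/x))" if "x \<noteq> 0" for x
  proof -
    have "mat3 1 0 0 0 x 0 0 0 (1/x) =
      (mat3 1 0 0 0 1 x 0 0 1 ** mat3 1 0 0 0 1 0 0 (-1/x) 1 ** mat3 1 0 0 0 1 x 0 0 1) **
      (mat3 1 0 0 0 1 (-1) 0 0 1 ** mat3 1 0 0 0 1 0 0 1 1 ** mat3 1 0 0 0 1 (-1) 0 0 1)"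
      using that by (simp add: mat3_mult)
    then show ?thesis by (simp add: covariant_mult covariant_shears)
  qed
  have "mat3 a 0 0 0 b 0 0 0 d = mat s ** (mat3 (a/s) 0 0 0 (1/(a/s)) 0 0 0 1 **
       mat3 1 0 0 0 (a*b/s^2) 0 0 0 (1/(a*b/s^2)))"
  proof -
    have "s * s ^ 2 = a * b * d" using s by (simp add: power3_eq_cube power2_eq_square mult.assoc)
    then have "d = s * (1 / (a * b / s ^ 2))" using assms s0 by (simp add: field_simps)
    then show ?thesis using s0 assms
      by (simp add: mat_mat3 mat3_mult power2_eq_square)
  qed
  moreover have "covariant (mat s ** (mat3 (a/s) 0 0 0 (1/(a/s)) 0 0 0 1 **
       mat3 1 0 0 0 (a*b/s^2) 0 0 0 (1/(a*b/s^2))))"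
    by (intro covariant_mult covariant_mat 1 2) (use assms s0 in auto)
  ultimately show ?thesis by (simp only:)
qed

text \<open>Shears produce the translation column, and the 2 by 2 block factors as lower shear,
  diagonal, upper shear as soon as its corner entry is nonzero.\<close>

lemma covariant_affine:
  assumes "a * d - b * c \<noteq> 0"
  shows "covariant (mat3 a b e c d f 0 0 1)"
proof -
  have *: "covariant (mat3 a b 0 c d 0 0 0 1)" if "a * d - b * c \<noteq> 0" "a \<noteq> 0" for a b c d
  proof -
    have "mat3 a b 0 c d 0 0 0 1 = mat3 1 0 0 (c/a) 1 0 0 0 1 ** mat3 a 0 0 0 ((a*d-b*c)/a) 0 0 0 1
        ** mat3 1 (b/a) 0 0 1 0 0 0 1"
      using that by (simp add: mat3_mult field_simps)
    then show ?thesis using that by (simp add: covariant_mult covariant_shears covariant_diag)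
  qed
  have **: "covariant (mat3 a b 0 c d 0 0 0 1)"
  proof (cases "a = 0")
    case True
    \<comment> \<open>With \<open>a = 0\<close> the determinant forces \<open>c \<noteq> 0\<close>;
      adding the second row to the first puts \<open>c\<close> into the corner.\<close>
    then have "mat3 a b 0 c d 0 0 0 1 = mat3 1 (-1) 0 0 1 0 0 0 1 ** mat3 c (b + d) 0 c d 0 0 0 1"
      by (simp add: mat3_mult)
    then show ?thesis using True assms
      by (auto simp: algebra_simps intro!: covariant_mult covariant_shears *)
  qed (use * assms in auto)
  have "mat3 a b e c d f 0 0 1 = mat3 1 0 e 0 1 0 0 0 1 ** mat3 1 0 0 0 1 f 0 0 1 ** mat3 a b 0 c d 0 0 0 1"
    by (simp add: mat3_mult)
  then show ?thesis using ** by (simp add: covariant_mult covariant_shears)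
qed

text \<open>A ternary cubic form is determined by its values, so two tensors need only be compared
  on the diagonal.\<close>

lemma disc3_cong:
  assumes "\<And>v. trilin c v v v = trilin c' v v v"
  shows "disc3 R c = disc3 R c'"
proof -
  have "cubic_form c = cubic_form c'"
    by (intro form3_eqI is_form_cubic_form) (simp add: teval_cubic_form assms)
  then show ?thesis by (simp add: disc3_def)
qed

end

section \<open>The discriminant of a Weierstrass cubic\<close>

definition weier :: "complex \<Rightarrow> complex \<Rightarrow> tensor3" where
  "weier g2 g3 = (\<lambda>i j k. if (i, j, k) = (2, 2, 3) then -1 else if (i, j, k) = (1, 1, 1) then 4
     else if (i, j, k) = (1, 3, 3) then - g2 else if (i, j, k) = (3, 3, 3) then - g3 else 0)"

definition fermat :: tensor3 where
  "fermat = (\<lambda>i j k. if i = j \<and> j = k then 1 else 0)"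

lemma trilin_weier:
  "trilin (weier g2 g3) u v w = - (u$2 * v$2 * w$3) + 4 * u$1 * v$1 * w$1 - g2 * u$1 * v$3 * w$3 - g3 * u$3 * v$3 * w$3"
  by (simp add: trilin_def weier_def sum_3)

lemma trilin_fermat: "trilin fermat u v w = u$1 * v$1 * w$1 + u$2 * v$2 * w$2 + u$3 * v$3 * w$3"
  by (simp add: trilin_def fermat_def sum_3)

lemma cubic_deriv_weier:
  "cubic_deriv (weier g2 g3) v w = w$1 * (12 * v$1^2 - g2 * v$3^2) + w$2 * (-2 * v$2 * v$3)
     + w$3 * (- (v$2^2) - 2 * g2 * v$1 * v$3 - 3 * g3 * v$3^2)"
  by (simp add: cubic_deriv_def trilin_weier algebra_simps power2_eq_square)

lemma polyfun_eqI:
  assumes "polyfun f" "polyfun g" "\<And>t. t \<noteq> 0 \<Longrightarrow> f t = g t"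
  shows "f t = g t"
proof -
  obtain p q where pq: "\<And>t. f t = poly p t" "\<And>t. g t = poly q t"
    using assms unfolding polyfun_def by blast
  have "poly ([:0, 1:] * (p - q)) t = 0" for t
    using assms(3)[of t] pq by (cases "t = 0") auto
  then have "[:0, 1:] * (p - q) = 0" by (intro poly_all_0_iff_0[THEN iffD1] allI)
  then have "p = q" by simp
  then show ?thesis using pq by simp
qed

text \<open>A function that is polynomial at both ends of the weighted projective line is a
  polynomial of bounded degree.\<close>

lemma degree_le_3_of_weighted_inversion:
  fixes p q :: "complex poly"
  assumes "\<And>t. t \<noteq> 0 \<Longrightarrow> poly p (t ^ 4) = t ^ 12 * poly q (inverse t ^ 6)"
  shows "degree p \<le> 3"
proof (cases "p = 0")
  case False
  define n where "n = degree q"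
  \<comment> \<open>\<open>P1\<close> and \<open>P2\<close> are the two sides multiplied by t^(6n),
    which clears the negative powers. Comparing degrees gives 6n + 4 deg p \<le> 12 + 6n.\<close>
  define P1 where "P1 = monom 1 (6 * n) * (p \<circ>\<^sub>p monom 1 4)"
  define P2 where "P2 = monom 1 12 * (\<Sum>k\<le>n. monom (coeff q k) (6 * (n - k)))"
  have "poly P1 t = poly P2 t" if "t \<noteq> 0" for t
  proof -
    have "t ^ (6 * n) * inverse t ^ (6 * k) = t ^ (6 * (n - k))" if "k \<le> n" for k
    proof -
      have "t ^ (6 * n) = t ^ (6 * (n - k)) * t ^ (6 * k)"
        using that by (simp add: power_add[symmetric] diff_mult_distrib2)
      then show ?thesis using \<open>t \<noteq> 0\<close> by (simp add: power_inverse)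
    qed
    then have "t ^ (6 * n) * poly q (inverse t ^ 6) = (\<Sum>k\<le>n. coeff q k * t ^ (6 * (n - k)))"
      unfolding poly_altdef n_def[symmetric] sum_distrib_left power_mult[symmetric]
      by (intro sum.cong) (auto simp: mult.left_commute)
    then show ?thesis
      using assms[OF that]
      by (simp add: P1_def P2_def poly_monom poly_pcompose poly_sum mult.left_commute)
  qed
  then have "poly P1 t = poly P2 t" for t
  proof -
    have "polyfun (poly P1)" "polyfun (poly P2)" unfolding polyfun_def by blast+
    then show ?thesis using polyfun_eqI \<open>\<And>t. t \<noteq> 0 \<Longrightarrow> poly P1 t = poly P2 t\<close> by metis
  qed
  then have eq: "P1 = P2" by (simp add: poly_eq_poly_eq_iff[symmetric] fun_eq_iff)
  have nz: "p \<circ>\<^sub>p monom 1 4 \<noteq> 0" using False by (simp add: pcompose_eq_0_iff degree_monom_eq)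
  have "degree P1 = 6 * n + 4 * degree p"
    unfolding P1_def by (subst degree_mult_eq) (use nz in \<open>auto simp: degree_monom_eq degree_pcompose\<close>)
  moreover have "degree P2 \<le> 12 + 6 * n"
    unfolding P2_def
  proof (rule order.trans[OF degree_mult_le add_mono])
    show "degree (\<Sum>k\<le>n. monom (coeff q k) (6 * (n - k))) \<le> 6 * n"
      by (intro degree_sum_le) (auto intro: order.trans[OF degree_monom_le])
  qed (auto simp: degree_monom_eq)
  ultimately show ?thesis using eq by simp
qed auto

lemma poly_degree_le_3:
  fixes p :: "complex poly"
  assumes "degree p \<le> 3"
  shows "poly p x = coeff p 0 + coeff p 1 * x + coeff p 2 * x^2 + coeff p 3 * x^3"
proof -
  have "poly p x = (\<Sum>i\<le>3. coeff p i * x ^ i)"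
    unfolding poly_altdef
    by (intro sum.mono_neutral_left) (use assms in \<open>auto simp: coeff_eq_0\<close>)
  then show ?thesis by (simp add: numeral_3_eq_3 numeral_2_eq_2)
qed

context quadrics_res
begin

lemma disc3_fermat: "disc3 R fermat = 3 ^ 12"
proof -
  have mon: "mon3 i i i = m + single i 1 \<longleftrightarrow> m = single i 2" for i m
  proof -
    have "mon3 i i i = single i 2 + single i 1"
      by (simp add: mon3_def single_add[symmetric] numeral_2_eq_2)
    then show ?thesis by (metis add_right_cancel)
  qed
  have mon': "m = single i 2" if "mon3 j j j = m + single i 1" for i j m
  proof -
    have "lookup (mon3 j j j) i \<noteq> 0" using that by (simp add: lookup_add)
    then have "i = j" by (auto simp: mon3_def lookup_add lookup_single when_def split: if_splits)
    then show ?thesis using that mon by simp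
  qed
  have *: "lookup (cubic_form fermat) (m + single i 1) = (if m = single i 2 then 1 else 0)" for i m
  proof -
    have "lookup (cubic_form fermat) (m + single i 1) = (\<Sum>j\<in>UNIV. if mon3 j j j = m + single i 1 then 1 else 0)"
    proof -
      have "(if mon3 k j l = m + single i 1 then fermat k j l else 0) =
        (if l = k then if j = k then (if mon3 k k k = m + single i 1 then 1 else 0) else 0 else 0)" for k j l
        by (auto simp: fermat_def)
      then show ?thesis unfolding lookup_cubic_form by (simp only: sum.delta finite if_True UNIV_I)
    qed
    also have "\<dots> = (\<Sum>j\<in>UNIV. if j = i then (if m = single i 2 then 1 else 0) else 0)"
    proof (intro sum.cong refl)
      fix j
      have "j = i" if "mon3 j j j = single i 2 + single i 1"
      proof -
        have "lookup (mon3 j j j) i \<noteq> 0" using that by (simp add: lookup_add)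
        then show ?thesis by (auto simp: mon3_def lookup_add lookup_single when_def split: if_splits)
      qed
      then show "(if mon3 j j j = m + single i 1 then 1 else 0) = (if j = i then (if m = single i 2 then 1 else 0) else 0)"
        using mon[of i m] mon'[of j m i] by auto
    qed
    also have "\<dots> = (if m = single i 2 then 1 else 0)" by simp
    finally show ?thesis .
  qed
  have "disc3 R fermat = 3 ^ 12 * coeff_eval R (\<lambda>i. single (single i 2) 1)"
    unfolding disc3_def
    by (rule coeff_eval_scale) (simp only: lookup_pdiff *, auto simp: lookup_single when_def)
  also have "coeff_eval R (\<lambda>i. single (single i 2) 1) = 1"
    using R unfolding quadrics_resultant_def by (elim conjE)
  finally show ?thesis by simp
qed

text \<open>The identity (by + cz)^3 + (-by + cz)^3 = 6 b^2 c y^2 z + 2 c^3 z^3 turns the Fermat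
  cubic into 4x^3 - y^2 z - z^3 once a^3 = 4, 6 b^2 c = -1 and 2 c^3 = -1.\<close>

lemma disc3_weier_0_1: "disc3 R (weier 0 1) = 2 ^ 12 * 3 ^ 6"
proof -
  obtain c :: complex where c: "-1/2 = c ^ 3" by (rule exists_complex_root[of 3 "-1/2"]) auto
  have c0: "c \<noteq> 0" using c by auto
  obtain b where b: "-1/(6*c) = b ^ 2" by (rule exists_complex_root[of 2 "-1/(6*c)"]) auto
  have b0: "b \<noteq> 0" using b c0 by auto
  obtain a :: complex where a: "4 = a ^ 3" by (rule exists_complex_root[of 3 4]) auto
  have a0: "a \<noteq> 0" using a by auto
  define A where "A = mat3 a 0 0 0 b c 0 (-b) c"
  have "A = mat3 1 0 0 0 1 0 0 (-1) 1 ** mat3 a 0 0 0 b 0 0 0 (2*c) ** mat3 1 0 0 0 1 (c/b) 0 0 1"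
    using b0 by (simp add: A_def mat3_mult)
  then have "covariant A"
    using a0 b0 c0 by (simp add: covariant_mult covariant_shears covariant_diag)
  then have "disc3 R (subst3 fermat A) = det A ^ 12 * disc3 R fermat"
    by (simp add: covariant_def)
  moreover have "disc3 R (subst3 fermat A) = disc3 R (weier 0 1)"
  proof (rule disc3_cong)
    fix v
    have "trilin (subst3 fermat A) v v v = a^3 * v$1^3 + 6 * c * b^2 * v$2^2 * v$3 + 2 * c^3 * v$3^3"
      by (simp add: trilin_subst3 trilin_fermat A_def mat3_mult_vec algebra_simps power2_eq_square power3_eq_cube)
    also have "a^3 = 4" using a by simp
    also have "6 * c * b^2 = - 1" using b[symmetric] c0 by simp
    also have "2 * c^3 = - 1" using c[symmetric] by simp
    finally show "trilin (subst3 fermat A) v v v = trilin (weier 0 1) v v v"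
      by (simp add: trilin_weier power2_eq_square power3_eq_cube)
  qed
  moreover have "det A ^ 12 = 2 ^ 12 / 3 ^ 6"
  proof -
    have "det A = 2 * a * b * c" by (simp add: A_def det_mat3)
    \<comment> \<open>The twelfth power depends only on a^3, c b^2 and c^3, so the choice of the
      roots does not matter.\<close>
    then have "det A ^ 12 = 2 ^ 12 * (a ^ 3) ^ 4 * (c * b ^ 2) ^ 6 * (c ^ 3) ^ 2"
      by (simp add: power_mult_distrib power_mult[symmetric] power_add[symmetric] mult_ac)
    also have "a ^ 3 = 4" using a by simp
    also have "c * b ^ 2 = - 1 / 6" using b[symmetric] c0 by simp
    also have "c ^ 3 = - 1 / 2" using c by simp
    finally show ?thesis by (simp add: power_divide)
  qed
  ultimately show ?thesis by (simp add: disc3_fermat)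
qed

text \<open>Substituting (t^2 x, t^3 y, z) multiplies the cubic by t^6. Degree 12 contributes t^72,
  the determinant t^5 contributes t^60, and t^12 remains.\<close>

lemma disc3_weier_homogeneous:
  assumes "t \<noteq> 0"
  shows "disc3 R (weier (t ^ 4 * x) (t ^ 6 * y)) = t ^ 12 * disc3 R (weier x y)"
proof -
  let ?A = "mat3 (t^2) 0 0 0 (t^3) 0 0 0 1"
  have "disc3 R (subst3 (weier (t ^ 4 * x) (t ^ 6 * y)) ?A) = (t ^ 5) ^ 12 * disc3 R (weier (t ^ 4 * x) (t ^ 6 * y))"
    using covariant_diag[of "t^2" "t^3" 1] assms
    by (simp add: covariant_def det_mat3 power_add[symmetric])
  moreover have "disc3 R (subst3 (weier (t ^ 4 * x) (t ^ 6 * y)) ?A) = disc3 R (\<lambda>i j k. t ^ 6 * weier x y i j k)"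
  proof (rule disc3_cong)
    fix v
    have "trilin (\<lambda>i j k. t ^ 6 * weier x y i j k) v v v = t ^ 6 * trilin (weier x y) v v v"
      by (simp add: trilin_def sum_distrib_left mult.assoc)
    then show "trilin (subst3 (weier (t ^ 4 * x) (t ^ 6 * y)) ?A) v v v = trilin (\<lambda>i j k. t ^ 6 * weier x y i j k) v v v"
      by (simp add: trilin_subst3 trilin_weier mat3_mult_vec)
        (simp add: algebra_simps power_numeral_reduce)
  qed
  ultimately have "(t ^ 6) ^ 12 * disc3 R (weier x y) = (t ^ 5) ^ 12 * disc3 R (weier (t ^ 4 * x) (t ^ 6 * y))"
    by (simp add: disc3_scale)
  moreover have "(t ^ 6) ^ 12 = (t ^ 5) ^ 12 * t ^ 12"
    by (simp add: power_mult[symmetric] power_add[symmetric])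
  ultimately have "(t ^ 5) ^ 12 * (t ^ 12 * disc3 R (weier x y)) = (t ^ 5) ^ 12 * disc3 R (weier (t ^ 4 * x) (t ^ 6 * y))"
    by (simp only: mult.assoc)
  moreover have "(t ^ 5) ^ 12 \<noteq> 0" using assms by simp
  ultimately show ?thesis by (metis mult_left_cancel)
qed

lemma polyfun_disc3_weier:
  assumes "polyfun f" "polyfun g"
  shows "polyfun (\<lambda>t. disc3 R (weier (f t) (g t)))"
proof -
  have "polyfun (\<lambda>t. - f t)" "polyfun (\<lambda>t. - g t)"
    using polyfun_mult[OF polyfun_const[of "-1"]] assms by fastforce+
  then show ?thesis
    by (intro polyfun_disc3) (auto simp: weier_def intro!: polyfun_if)
qed

text \<open>A polynomial in \<open>x\<close> of degree at most 3, invariant under multiplication by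
  a cube root of unity, has the form u + v x^3. The value at 0 and a zero at \<open>x = 3\<close>
  determine u and v.\<close>

lemma disc3_weier_1: "disc3 R (weier x 1) = 2 ^ 12 * 3 ^ 6 * (1 - x ^ 3 / 27)"
proof -
  obtain p where p: "\<And>x. disc3 R (weier x 1) = poly p x"
    using polyfun_disc3_weier[OF polyfun_id polyfun_const[of 1]] by (auto simp: polyfun_def)
  obtain q where q: "\<And>x. disc3 R (weier 1 x) = poly q x"
    using polyfun_disc3_weier[OF polyfun_const[of 1] polyfun_id] by (auto simp: polyfun_def)
  \<comment> \<open>Scaling relates the arguments (t^4, 1) and (1, t^(-6)), two charts of the
    weighted line.\<close>
  have "poly p (t ^ 4) = t ^ 12 * poly q (inverse t ^ 6)" if "t \<noteq> 0" for t
    using disc3_weier_homogeneous[OF that, of 1 "inverse t ^ 6"] that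
    by (simp add: p q power_inverse)
  then have deg: "degree p \<le> 3" by (rule degree_le_3_of_weighted_inversion)
  define \<omega> where "\<omega> = Complex (-1/2) (sqrt 3 / 2)"
  have w2: "\<omega> ^ 2 = -1 - \<omega>"
    by (simp add: \<omega>_def complex_eq_iff power2_eq_square)
  have w3: "\<omega> ^ 3 = 1"
  proof -
    have "\<omega> ^ 3 = \<omega> * \<omega> ^ 2" by (simp add: power3_eq_cube power2_eq_square)
    also have "\<dots> = \<omega> * (- 1 - \<omega>)" by (simp only: w2)
    also have "\<dots> = - \<omega> - \<omega> ^ 2" by (simp add: algebra_simps power2_eq_square)
    also have "\<dots> = 1" unfolding w2 by simp
    finally show ?thesis .
  qed
  have w0: "\<omega> \<noteq> 0" by (simp add: \<omega>_def complex_eq_iff)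
  have rot: "poly p (\<omega> * x) = poly p x" for x
  proof -
    have "\<omega> ^ 4 = \<omega> ^ 3 * \<omega>" "\<omega> ^ 6 = (\<omega> ^ 3) ^ 2" "\<omega> ^ 12 = (\<omega> ^ 3) ^ 4"
      by (simp_all add: power_mult[symmetric] power_numeral_reduce)
    then show ?thesis
      using disc3_weier_homogeneous[OF w0, of x 1] w3 by (simp add: p)
  qed
  have form: "poly p x = coeff p 0 + coeff p 3 * x ^ 3" for x
  proof -
    \<comment> \<open>Summing over the three rotations keeps only the exponents divisible by
      3.\<close>
    have "3 * poly p x = poly p x + poly p (\<omega> * x) + poly p (\<omega> * (\<omega> * x))"
      by (simp add: rot)
    also have "\<dots> = 3 * coeff p 0 + coeff p 1 * x * (1 + \<omega> + \<omega> ^ 2)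
        + coeff p 2 * x ^ 2 * (1 + \<omega> ^ 2 + \<omega> ^ 3 * \<omega>) + coeff p 3 * x ^ 3 * (1 + \<omega> ^ 3 + \<omega> ^ 3 * \<omega> ^ 3)"
      unfolding poly_degree_le_3[OF deg] by (simp add: algebra_simps power_numeral_reduce)
    also have "\<dots> = 3 * (coeff p 0 + coeff p 3 * x ^ 3)"
      unfolding w3 unfolding w2 by (simp add: algebra_simps)
    finally show ?thesis by (metis mult_cancel_left zero_neq_numeral)
  qed
  \<comment> \<open>4X^3 - 3X - 1 = (X - 1)(2X + 1)^2 has the double root -1/2, which is the
    abscissa of a node.\<close>
  have "singular3 (weier 3 1)"
    unfolding singular3_def
  proof (intro exI conjI allI)
    show "vector [-1/2, 0, 1] \<noteq> (0 :: complex^3)" by (simp add: vec_eq_iff forall_3)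
    show "cubic_deriv (weier 3 1) (vector [-1/2, 0, 1]) w = 0" for w
      by (simp add: cubic_deriv_weier power2_eq_square)
  qed
  then have "poly p 3 = 0" using disc3_eq_0_iff p by metis
  moreover have "poly p 0 = 2 ^ 12 * 3 ^ 6" using disc3_weier_0_1 p by metis
  ultimately have "coeff p 0 = 2 ^ 12 * 3 ^ 6" "coeff p 3 = - (2 ^ 12 * 3 ^ 3)"
    unfolding form by (simp_all, algebra)
  then show ?thesis unfolding p form by (simp add: algebra_simps)
qed

text \<open>For \<open>y \<noteq> 0\<close> a sixth root of 1/y rescales the second argument to 1;
  the value \<open>y = 0\<close> follows because both sides are polynomial in
  \<open>y\<close>.\<close>

lemma disc3_weier: "disc3 R (weier x y) = - 27 * 2 ^ 12 * (x ^ 3 - 27 * y ^ 2)"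
proof (rule polyfun_eqI[of "\<lambda>y. disc3 R (weier x y)" "\<lambda>y. - 27 * 2 ^ 12 * (x ^ 3 - 27 * y ^ 2)"])
  have "polyfun (\<lambda>y. - 27 * 2 ^ 12 * (x ^ 3 + - 27 * y ^ 2))"
    by (intro polyfun_mult polyfun_add polyfun_const polyfun_power polyfun_id)
  then show "polyfun (\<lambda>y. - 27 * 2 ^ 12 * (x ^ 3 - 27 * y ^ 2))" by simp
  show "polyfun (\<lambda>y. disc3 R (weier x y))" by (intro polyfun_disc3_weier) auto
  fix y :: complex
  assume y: "y \<noteq> 0"
  obtain t where t: "inverse y = t ^ 6" by (rule exists_complex_root[of 6 "inverse y"]) auto
  have t0: "t \<noteq> 0" using t y by auto
  have ty: "t ^ 6 * y = 1" using t[symmetric] y by simp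
  have "t ^ 12 * disc3 R (weier x y) = disc3 R (weier (t ^ 4 * x) 1)"
    using disc3_weier_homogeneous[OF t0, of x y] ty by simp
  also have "\<dots> = 2 ^ 12 * 3 ^ 6 * ((t ^ 6 * y) ^ 2 - (t ^ 4 * x) ^ 3 / 27)"
    unfolding disc3_weier_1 ty by simp
  also have "\<dots> = t ^ 12 * (- 27 * 2 ^ 12 * (x ^ 3 - 27 * y ^ 2))"
    by (simp add: power_mult_distrib power_mult[symmetric] algebra_simps)
  finally show "disc3 R (weier x y) = - 27 * 2 ^ 12 * (x ^ 3 - 27 * y ^ 2)"
    using t0 by simp
qed

text \<open>In homogeneous coordinates the substitution is a matrix with last row (0, 0, 1) and
  determinant \<open>l11 * l22 - l12 * l21\<close>, so covariance reduces the claim to the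
  Weierstrass family.\<close>

theorem cubic_discriminant_weierstrass:
  assumes "is_form 3 \<phi>" and D: "l11 * l22 - l12 * l21 \<noteq> 0"
    and "\<And>X Y. teval \<phi> (vector [l11 * X + l12 * Y + l13, l21 * X + l22 * Y + l23, 1])
        = - (Y ^ 2) + 4 * X ^ 3 - g2 * X - g3"
  shows "cubic_discriminant R \<phi> = 2 ^ 12 * (g2 ^ 3 - 27 * g3 ^ 2) / (l11 * l22 - l12 * l21) ^ 12"
proof -
  obtain c where c: "\<phi> = cubic_form c" using form3_tensor_exists[OF assms(1)] .
  let ?M = "mat3 l11 l12 l13 l21 l22 l23 0 0 1"
  have "cubic_form (subst3 c ?M) = cubic_form (weier g2 g3)"
  proof (intro form3_eqI is_form_cubic_form)
    fix t :: complex
    show "teval (cubic_form (subst3 c ?M)) (vector [t, t ^ 4, 1]) = teval (cubic_form (weier g2 g3)) (vector [t, t ^ 4, 1])"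
      using assms(3)[of t "t ^ 4"] 
      by (simp add: teval_cubic_form trilin_subst3 c mat3_mult_vec)
        (simp add: trilin_weier power2_eq_square power3_eq_cube)
  qed
  then have "disc3 R (weier g2 g3) = disc3 R (subst3 c ?M)" by (simp add: disc3_def)
  also have "\<dots> = (l11 * l22 - l12 * l21) ^ 12 * disc3 R c"
    using covariant_affine[OF D] by (simp add: covariant_def det_mat3)
  \<comment> \<open>This -27 cancels the one in \<open>disc3_weier\<close> and leaves 2^12.\<close>
  also have "disc3 R c = - 27 * cubic_discriminant R \<phi>"
    by (simp add: cubic_discriminant_def disc3_def c)
  finally have "2 ^ 12 * (g2 ^ 3 - 27 * g3 ^ 2) = (l11 * l22 - l12 * l21) ^ 12 * cubic_discriminant R \<phi>"
    unfolding disc3_weier by algebra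
  then show ?thesis using D by (simp add: field_simps)
qed

end

section \<open>The triple product and the theta constants\<close>

lemma norm_square_less_1: "norm x < 1 \<Longrightarrow> norm (x ^ 2) < 1" for x :: complex
  by (simp add: norm_power power_less_one_iff abs_square_less_1)

text \<open>The infinite q-Pochhammer symbol (x; Q).\<close>

definition qphi :: "complex \<Rightarrow> complex \<Rightarrow> complex" where
  "qphi Q x = prodinf (\<lambda>k. 1 - Q ^ k * x)"

lemma qphi_convergent:
  fixes Q x :: complex
  assumes "norm Q < 1"
  shows "convergent_prod (\<lambda>k. 1 - Q ^ k * x)"
proof -
  have "summable (\<lambda>k. norm Q ^ k * norm x)"
    using assms by (intro summable_mult2 summable_geometric) auto
  moreover have "norm ((1 - Q ^ k * x) - 1) = norm Q ^ k * norm x" for k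
    by (simp add: norm_mult norm_power)
  ultimately have "summable (\<lambda>k. norm ((1 - Q ^ k * x) - 1))"
    by (simp only:)
  then show ?thesis
    by (intro summable_imp_abs_convergent_prod abs_convergent_prod_imp_convergent_prod)
qed

lemma qphi_LIMSEQ:
  assumes "norm Q < 1"
  shows "(\<lambda>n. \<Prod>k<n. 1 - Q ^ k * x) \<longlonglongrightarrow> qphi Q x"
  using convergent_prod_has_prod[OF qphi_convergent[OF assms]] has_prod_imp_tendsto'
  unfolding qphi_def by blast

lemma qphi_nonzero:
  assumes "norm Q < 1" "\<And>k. Q ^ k * x \<noteq> 1"
  shows "qphi Q x \<noteq> 0"
  unfolding qphi_def by (rule prodinf_nonzero[OF qphi_convergent[OF assms(1)]]) (use assms(2) in auto)

lemma qphi_nonzero':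
  assumes "norm Q < 1" "norm x < 1"
  shows "qphi Q x \<noteq> 0"
proof (rule qphi_nonzero[OF assms(1)])
  fix k
  have "norm (Q ^ k * x) \<le> 1 * norm x"
    unfolding norm_mult norm_power using assms by (intro mult_right_mono power_le_one) auto
  then show "Q ^ k * x \<noteq> 1" using assms(2) by auto
qed

lemma qphi_step:
  assumes "norm Q < 1"
  shows "qphi Q x = (1 - x) * qphi Q (Q * x)"
proof (rule LIMSEQ_unique)
  show "(\<lambda>n. \<Prod>k<Suc n. 1 - Q ^ k * x) \<longlonglongrightarrow> qphi Q x"
    by (rule LIMSEQ_Suc[OF qphi_LIMSEQ[OF assms]])
  have "(\<Prod>k<Suc n. 1 - Q ^ k * x) = (1 - x) * (\<Prod>k<n. 1 - Q ^ k * (Q * x))" for n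
    unfolding prod.lessThan_Suc_shift by (simp add: mult_ac)
  then show "(\<lambda>n. \<Prod>k<Suc n. 1 - Q ^ k * x) \<longlonglongrightarrow> (1 - x) * qphi Q (Q * x)"
    using tendsto_mult_left[OF qphi_LIMSEQ[OF assms]] by simp
qed

lemma qphi_mult_uminus:
  assumes "norm Q < 1"
  shows "qphi Q x * qphi Q (- x) = qphi (Q ^ 2) (x ^ 2)"
proof (rule LIMSEQ_unique)
  have Q2: "norm (Q ^ 2) < 1"
    using norm_square_less_1[OF assms] .
  show "(\<lambda>n. (\<Prod>k<n. 1 - Q ^ k * x) * (\<Prod>k<n. 1 - Q ^ k * (- x))) \<longlonglongrightarrow> qphi Q x * qphi Q (- x)"
    by (intro tendsto_mult qphi_LIMSEQ assms)
  have "(\<Prod>k<n. 1 - Q ^ k * x) * (\<Prod>k<n. 1 - Q ^ k * (- x)) = (\<Prod>k<n. 1 - (Q ^ 2) ^ k * x ^ 2)" for n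
    unfolding prod.distrib[symmetric]
    by (intro prod.cong) (auto simp: algebra_simps power2_eq_square power_mult_distrib)
  then show "(\<lambda>n. (\<Prod>k<n. 1 - Q ^ k * x) * (\<Prod>k<n. 1 - Q ^ k * (- x))) \<longlonglongrightarrow> qphi (Q ^ 2) (x ^ 2)"
    using qphi_LIMSEQ[OF Q2] by simp
qed

text \<open>Even and odd indices are separated, along the partial products of even length.\<close>

lemma qphi_split:
  assumes "norm Q < 1"
  shows "qphi Q x = qphi (Q ^ 2) x * qphi (Q ^ 2) (Q * x)"
proof (rule LIMSEQ_unique)
  have Q2: "norm (Q ^ 2) < 1"
    using norm_square_less_1[OF assms] .
  show "(\<lambda>n. \<Prod>k<2 * n. 1 - Q ^ k * x) \<longlonglongrightarrow> qphi Q x"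
    using LIMSEQ_subseq_LIMSEQ[OF qphi_LIMSEQ[OF assms], of "\<lambda>n. 2 * n"]
    by (simp add: o_def strict_mono_def)
  have "(\<Prod>k<2 * n. 1 - Q ^ k * x) = (\<Prod>k<n. 1 - (Q ^ 2) ^ k * x) * (\<Prod>k<n. 1 - (Q ^ 2) ^ k * (Q * x))" for n
    by (induction n) (simp_all add: power_mult[symmetric] algebra_simps)
  then show "(\<lambda>n. \<Prod>k<2 * n. 1 - Q ^ k * x) \<longlonglongrightarrow> qphi (Q ^ 2) x * qphi (Q ^ 2) (Q * x)"
    by (simp add: tendsto_mult qphi_LIMSEQ Q2)
qed

text \<open>Euler's observation that partitions into distinct parts and into odd parts are
  equinumerous.\<close>

lemma qphi_euler:
  assumes "norm q < 1"
  shows "qphi (q ^ 2) (- (q ^ 2)) * qphi (q ^ 2) q * qphi (q ^ 2) (- q) = 1"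
proof -
  define Q where "Q = q ^ 2"
  have Q: "norm Q < 1" unfolding Q_def by (rule norm_square_less_1[OF assms])
  have Q2: "norm (Q ^ 2) < 1" using norm_square_less_1[OF Q] .
  have 1: "qphi Q q * qphi Q (- q) = qphi (Q ^ 2) Q"
    using qphi_mult_uminus[OF Q, of q] by (simp add: Q_def)
  have 2: "qphi Q Q * qphi Q (- Q) = qphi (Q ^ 2) (Q ^ 2)"
    by (rule qphi_mult_uminus[OF Q])
  have 3: "qphi Q Q = qphi (Q ^ 2) Q * qphi (Q ^ 2) (Q ^ 2)"
    using qphi_split[OF Q, of Q] by (simp add: power2_eq_square)
  have "qphi (Q ^ 2) (Q ^ 2) \<noteq> 0" using qphi_nonzero'[OF Q2 Q2] .
  \<comment> \<open>Combining the three relations leaves the nonzero factor (Q^2; Q^2) on both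
    sides, where it cancels.\<close>
  moreover have "qphi (Q ^ 2) (Q ^ 2) * (qphi Q (- Q) * (qphi Q q * qphi Q (- q))) = qphi (Q ^ 2) (Q ^ 2) * 1"
    using 2 unfolding 1 3 by (simp add: mult_ac)
  ultimately have "qphi Q (- Q) * (qphi Q q * qphi Q (- q)) = 1"
    by (metis mult_left_cancel)
  then show ?thesis by (simp add: Q_def mult.assoc)
qed

section \<open>Gaussian binomial coefficients and the finite triple product\<close>

fun qbin :: "complex \<Rightarrow> nat \<Rightarrow> nat \<Rightarrow> complex" where
  "qbin Q n 0 = 1"
| "qbin Q 0 (Suc j) = 0"
| "qbin Q (Suc n) (Suc j) = qbin Q n j + Q ^ Suc j * qbin Q n (Suc j)"

lemma qbin_eq_0: "n < j \<Longrightarrow> qbin Q n j = 0"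
  by (induction Q n j rule: qbin.induct) auto

lemma qbin_same: "qbin Q n n = 1"
  by (induction n) (simp_all add: qbin_eq_0)

text \<open>The q-binomial theorem with base q^2, which replaces the usual exponent j(j-1)/2 by
  j(j-1). The induction splits off the factor k = 0 and applies the hypothesis at q^2 y.\<close>

lemma qbinomial:
  "(\<Prod>k<N. 1 + (q ^ 2) ^ k * y) = (\<Sum>j\<le>N. qbin (q ^ 2) N j * q ^ (j * (j - 1)) * y ^ j)"
proof (induction N arbitrary: y)
  case (Suc N)
  define b where "b = (\<lambda>j. qbin (q ^ 2) N j)"
  have b: "b (Suc N) = 0" by (simp add: b_def qbin_eq_0)
  have "(\<Prod>k<Suc N. 1 + (q ^ 2) ^ k * y) = (1 + y) * (\<Prod>k<N. 1 + (q ^ 2) ^ k * (q ^ 2 * y))"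
    unfolding prod.lessThan_Suc_shift by (simp add: mult_ac)
  also have "\<dots> = (1 + y) * (\<Sum>j\<le>N. b j * q ^ (j * (j - 1)) * (q ^ 2 * y) ^ j)"
    by (simp add: Suc.IH b_def)
  also have "(\<Sum>j\<le>N. b j * q ^ (j * (j - 1)) * (q ^ 2 * y) ^ j) = (\<Sum>j\<le>N. b j * q ^ (j * (j + 1)) * y ^ j)"
  proof (intro sum.cong refl)
    fix j :: nat
    have "j * (j - 1) + 2 * j = j * (j + 1)" by (cases j) auto
    then have "q ^ (j * (j - 1)) * (q ^ 2) ^ j = q ^ (j * (j + 1))"
      by (simp only: power_mult[symmetric] power_add[symmetric])
    then show "b j * q ^ (j * (j - 1)) * (q ^ 2 * y) ^ j = b j * q ^ (j * (j + 1)) * y ^ j"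
      by (simp add: power_mult_distrib mult.assoc)
  qed
  also have "(1 + y) * (\<Sum>j\<le>N. b j * q ^ (j * (j + 1)) * y ^ j) =
      (\<Sum>j\<le>N. b j * q ^ (j * (j + 1)) * y ^ j) + (\<Sum>j\<le>N. b j * q ^ (j * (j + 1)) * y ^ Suc j)"
    unfolding distrib_right[of 1 y] mult_1_left sum_distrib_left[of y] power_Suc by (simp only: mult_ac)
  also have "(\<Sum>j\<le>N. b j * q ^ (j * (j + 1)) * y ^ j) = (\<Sum>j\<le>Suc N. b j * q ^ (j * (j + 1)) * y ^ j)"
    by (simp add: b)
  also have "\<dots> = 1 + (\<Sum>j\<le>N. b (Suc j) * q ^ (Suc j * (Suc j + 1)) * y ^ Suc j)"
    unfolding sum.atMost_Suc_shift by (simp add: b_def)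
  finally have "(\<Prod>k<Suc N. 1 + (q ^ 2) ^ k * y) = 1 +
      (\<Sum>j\<le>N. (b (Suc j) * q ^ (Suc j * (Suc j + 1)) + b j * q ^ (j * (j + 1))) * y ^ Suc j)"
    by (simp only: sum.distrib distrib_right add.assoc)
  also have "(\<Sum>j\<le>N. (b (Suc j) * q ^ (Suc j * (Suc j + 1)) + b j * q ^ (j * (j + 1))) * y ^ Suc j) =
    (\<Sum>j\<le>N. qbin (q ^ 2) (Suc N) (Suc j) * q ^ (Suc j * (Suc j - 1)) * y ^ Suc j)"
  proof (intro sum.cong refl)
    fix j
    have "Suc j * (Suc j + 1) = 2 * Suc j + j * (j + 1)" by simp
    then have "q ^ (Suc j * (Suc j + 1)) = (q ^ 2) ^ Suc j * q ^ (j * (j + 1))"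
      by (simp only: power_add power_mult)
    moreover have "Suc j * (Suc j - 1) = j * (j + 1)" by simp
    ultimately show "(b (Suc j) * q ^ (Suc j * (Suc j + 1)) + b j * q ^ (j * (j + 1))) * y ^ Suc j =
      qbin (q ^ 2) (Suc N) (Suc j) * q ^ (Suc j * (Suc j - 1)) * y ^ Suc j"
      by (simp only: qbin.simps b_def[symmetric]) (simp add: algebra_simps del: power_Suc)
  qed
  finally show ?case unfolding sum.atMost_Suc_shift[of _ N] by simp
qed simp

definition qfact :: "complex \<Rightarrow> nat \<Rightarrow> complex" where
  "qfact Q n = (\<Prod>k<n. 1 - Q ^ k * Q)"

lemma qfact_Suc: "qfact Q (Suc n) = qfact Q n * (1 - Q ^ Suc n)"
  by (simp add: qfact_def mult.commute)

text \<open>The Pascal recurrence avoids division; this is the quotient formula with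
  \<open>qfact Q n\<close> = (Q; Q)_n, from which limits and bounds of the coefficients are read
  off.\<close>

lemma qbin_qfact: "j \<le> n \<Longrightarrow> qbin Q n j * qfact Q j * qfact Q (n - j) = qfact Q n"
proof (induction Q n j rule: qbin.induct)
  case (3 Q n j)
  show ?case
  proof (cases "j = n")
    case True
    then show ?thesis by (simp add: qbin_same qfact_Suc qfact_def[of _ 0])
  next
    case False
    then have jn: "Suc j \<le> n" using 3 by simp
    have e: "n - j = Suc (n - Suc j)" using jn by simp
    have "qbin Q (Suc n) (Suc j) * qfact Q (Suc j) * qfact Q (Suc n - Suc j)
      = qbin Q n j * qfact Q j * qfact Q (n - j) * (1 - Q ^ Suc j)
        + Q ^ Suc j * (qbin Q n (Suc j) * qfact Q (Suc j) * qfact Q (n - Suc j)) * (1 - Q ^ (n - j))"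
      unfolding qbin.simps diff_Suc_Suc by (simp add: qfact_Suc e algebra_simps)
    also have "\<dots> = qfact Q n * (1 - Q ^ Suc j) + Q ^ Suc j * qfact Q n * (1 - Q ^ (n - j))"
      using 3 jn by simp
    also have "\<dots> = qfact Q n * (1 - Q ^ Suc j * Q ^ (n - j))" by (simp add: algebra_simps)
    also have "Q ^ Suc j * Q ^ (n - j) = Q ^ Suc n" using jn by (simp only: power_add[symmetric]) simp
    finally show ?thesis by (simp only: qfact_Suc)
  qed
qed (auto simp: qfact_def)

text \<open>The q-binomial theorem for 2n factors, recentred by y = q^(1-2n) x. The upper n factors
  are 1 + q^(2k+1) x; the lower n, read backwards, are x q^(-2k-1) (1 + q^(2k+1) / x).\<close>

lemma finite_triple_product:
  assumes "q \<noteq> 0" "x \<noteq> 0"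
  shows "(\<Prod>k<n. 1 + (q ^ 2) ^ k * (q * x)) * (\<Prod>k<n. 1 + (q ^ 2) ^ k * (q / x)) =
    (\<Sum>k\<in>{- int n..int n}. qbin (q ^ 2) (2 * n) (nat (k + int n)) * q ^ nat (k ^ 2) * x powi k)"
proof -
  define y where "y = q * x / q ^ (2 * n)"
  have "(\<Prod>k<n + m. f k) = (\<Prod>k<n. f k) * (\<Prod>k<m. f (n + k))" for f :: "nat \<Rightarrow> complex" and m
    by (induction m) (simp_all add: mult.assoc)
  from this[of _ n] have "(\<Prod>k<2*n. 1 + (q ^ 2) ^ k * y) = (\<Prod>k<n. 1 + (q ^ 2) ^ k * y) * (\<Prod>k<n. 1 + (q ^ 2) ^ (n + k) * y)"
    by (simp add: mult_2)
  also have "(\<Prod>k<n. 1 + (q ^ 2) ^ (n + k) * y) = (\<Prod>k<n. 1 + (q ^ 2) ^ k * (q * x))"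
    using assms by (intro prod.cong refl) (simp add: y_def power_add power_mult)
  also have "(\<Prod>k<n. 1 + (q ^ 2) ^ k * y) = (\<Prod>k<n. 1 + (q ^ 2) ^ (n - Suc k) * y)"
    by (rule prod.nat_diff_reindex[symmetric])
  also have "\<dots> = (\<Prod>k<n. x / (q * (q ^ 2) ^ k) * (1 + (q ^ 2) ^ k * (q / x)))"
  proof (intro prod.cong refl)
    fix k assume "k \<in> {..<n}"
    then have "2 * (n - Suc k) + (2 * k + 2) = 2 * n" by auto
    then have "q ^ (2 * n) = (q ^ 2) ^ (n - Suc k) * (q ^ 2) ^ k * q ^ 2"
      by (simp only: power_mult[symmetric] power_add[symmetric] add.assoc)
    then show "1 + (q ^ 2) ^ (n - Suc k) * y = x / (q * (q ^ 2) ^ k) * (1 + (q ^ 2) ^ k * (q / x))"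
      using assms by (simp add: y_def field_simps power2_eq_square)
  qed
  also have "\<dots> = x ^ n / q ^ (n ^ 2) * (\<Prod>k<n. 1 + (q ^ 2) ^ k * (q / x))"
  proof -
    have "(\<Prod>k<n. x / (q * (q ^ 2) ^ k)) = x ^ n / q ^ (n ^ 2)"
    proof (induction n)
      case (Suc n)
      have "Suc n ^ 2 = n ^ 2 + (1 + 2 * n)" by (simp add: power2_eq_square)
      then have "q ^ (Suc n ^ 2) = q ^ (n ^ 2) * (q * (q ^ 2) ^ n)"
        by (simp only: power_add power_mult power_one_right)
      then show ?case using Suc by simp
    qed simp
    then show ?thesis by (simp only: prod.distrib)
  qed
  finally have "(\<Prod>k<n. 1 + (q ^ 2) ^ k * (q * x)) * (\<Prod>k<n. 1 + (q ^ 2) ^ k * (q / x))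
      = q ^ (n ^ 2) / x ^ n * (\<Prod>k<2*n. 1 + (q ^ 2) ^ k * y)"
    using assms by (simp add: field_simps)
  also have "\<dots> = (\<Sum>j\<le>2*n. qbin (q ^ 2) (2 * n) j * (q ^ (n ^ 2) / x ^ n * q ^ (j * (j - 1)) * y ^ j))"
    unfolding qbinomial sum_distrib_left by (simp add: mult_ac)
  also have "\<dots> = (\<Sum>j\<le>2*n. qbin (q ^ 2) (2 * n) j * (q ^ nat ((int j - int n) ^ 2) * x powi (int j - int n)))"
  proof (rule sum.cong[OF refl], rule arg_cong2[where f = "(*)", OF refl])
    fix j
    \<comment> \<open>Completing the square, n^2 + j(j-1) + j - 2nj = (j-n)^2: this is the source of
      the quadratic exponents.\<close>
    have "int (n ^ 2 + j * j) = (int j - int n) ^ 2 + 2 * int n * int j"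
      by (simp add: power2_eq_square algebra_simps)
    then have "int (n ^ 2 + j * j) = int (nat ((int j - int n) ^ 2) + 2 * n * j)" by simp
    moreover have "j * (j - 1) + j = j * j" by (cases j) auto
    ultimately have "n ^ 2 + (j * (j - 1) + j) = nat ((int j - int n) ^ 2) + 2 * n * j"
      by (simp only: of_nat_eq_iff)
    then have "q ^ (n ^ 2) * (q ^ (j * (j - 1)) * q ^ j) = q ^ nat ((int j - int n) ^ 2) * (q ^ (2 * n)) ^ j"
      by (simp only: power_mult[symmetric] power_add[symmetric])
    then have 1: "q ^ (n ^ 2) * (q ^ (j * (j - 1)) * q ^ j) / (q ^ (2 * n)) ^ j = q ^ nat ((int j - int n) ^ 2)"
      using assms(1) by (simp only: nonzero_mult_div_cancel_right power_not_zero not_False_eq_True)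
    have 2: "x powi (int j - int n) = x ^ j / x ^ n"
      using assms by (simp add: power_int_diff)
    have y: "y ^ j = q ^ j * x ^ j / (q ^ (2 * n)) ^ j"
      by (simp add: y_def power_mult_distrib power_divide)
    show "q ^ (n ^ 2) / x ^ n * q ^ (j * (j - 1)) * y ^ j =
        q ^ nat ((int j - int n) ^ 2) * x powi (int j - int n)"
      unfolding y 1[symmetric] 2 by (simp add: mult_ac)
  qed
  also have "\<dots> = (\<Sum>k\<in>{- int n..int n}. qbin (q ^ 2) (2 * n) (nat (k + int n)) * q ^ nat (k ^ 2) * x powi k)"
    by (rule sum.reindex_bij_witness[of _ "\<lambda>k. nat (k + int n)" "\<lambda>j. int j - int n"])
      (auto simp: mult.assoc)
  finally show ?thesis .
qed

section \<open>The triple product as a limit\<close>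

lemma summable_gaussian:
  fixes r s :: real
  assumes "0 \<le> r" "r < 1" "0 \<le> s"
  shows "summable (\<lambda>k. r ^ (k ^ 2) * s ^ k)"
proof (rule summable_comparison_test_ev)
  \<comment> \<open>Each term is the k-th power of r^k s, which tends to 0 and so eventually stays
    below 1/2.\<close>
  have "(\<lambda>k. r ^ k * s) \<longlonglongrightarrow> 0 * s"
    using assms by (intro tendsto_mult_right LIMSEQ_realpow_zero) auto
  then have "eventually (\<lambda>k. r ^ k * s < 1 / 2) sequentially"
    by (rule order_tendstoD(2)) simp
  then show "eventually (\<lambda>k. norm (r ^ (k ^ 2) * s ^ k) \<le> (1 / 2) ^ k) sequentially"
  proof eventually_elim
    case (elim k)
    have "r ^ (k ^ 2) * s ^ k = (r ^ k * s) ^ k"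
      by (simp add: power2_eq_square power_mult power_mult_distrib)
    also have "\<dots> \<le> (1 / 2) ^ k"
      using elim assms by (intro power_mono) auto
    finally show ?case using assms by simp
  qed
  show "summable (\<lambda>k. (1 / 2 :: real) ^ k)" by (intro summable_geometric) simp
qed

lemma summable_on_int_nonneg:
  fixes f :: "int \<Rightarrow> real"
  assumes nonneg: "\<And>k. 0 \<le> f k"
    and "summable (\<lambda>n. f (int n))" "summable (\<lambda>n. f (- int n))"
  shows "f summable_on UNIV"
proof -
  have "f summable_on (range int)"
    using assms by (subst summable_on_reindex) (simp_all add: o_def summable_on_UNIV_nonneg_real_iff)
  moreover have "f summable_on (range (\<lambda>k. - int k))"
    using assms by (subst summable_on_reindex) (simp_all add: o_def summable_on_UNIV_nonneg_real_iff inj_on_def)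
  then have "f summable_on (range (\<lambda>k. - int k) - range int)"
    by (rule summable_on_subset_banach) auto
  ultimately have "f summable_on (range int \<union> (range (\<lambda>k. - int k) - range int))"
    by (rule summable_on_Un_disjoint) auto
  moreover have "k \<in> range int \<or> k \<in> range (\<lambda>k. - int k)" for k :: int
    by (cases k rule: int_cases2) auto
  then have "range int \<union> (range (\<lambda>k. - int k) - range int) = UNIV" by auto
  ultimately show ?thesis by simp
qed

lemma theta_term_abs_summable:
  fixes q x :: complex
  assumes "norm q < 1" "x \<noteq> 0"
  shows "(\<lambda>k::int. norm (q ^ nat (k ^ 2) * x powi k)) summable_on UNIV"
proof -
  let ?f = "\<lambda>k::int. norm (q ^ nat (k ^ 2) * x powi k)"
  have 1: "summable (\<lambda>k. ?f (int k))"
  proof -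
    have "nat (int k ^ 2) = k ^ 2" for k by (simp add: nat_power_eq)
    then show ?thesis
      using summable_gaussian[of "norm q" "norm x"] assms unfolding norm_mult norm_power by (simp add: norm_power)
  qed
  have 2: "summable (\<lambda>k. ?f (- int k))"
  proof -
    have "nat ((- int k) ^ 2) = k ^ 2" for k by (simp add: nat_power_eq)
    then show ?thesis
      using summable_gaussian[of "norm q" "norm (inverse x)"] assms
      unfolding norm_mult norm_power by (simp add: norm_power norm_inverse power_int_minus power_inverse)
  qed
  show ?thesis using 1 2 by (intro summable_on_int_nonneg) auto
qed

lemma qfact_LIMSEQ: "norm Q < 1 \<Longrightarrow> qfact Q \<longlonglongrightarrow> qphi Q Q"
  unfolding qfact_def by (rule qphi_LIMSEQ)

lemma qfact_nonzero:
  assumes "norm Q < 1"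
  shows "qfact Q n \<noteq> 0"
proof -
  have "Q ^ k * Q \<noteq> 1" for k
  proof -
    have "norm (Q ^ k * Q) \<le> 1 * norm Q"
      unfolding norm_mult norm_power using assms by (intro mult_right_mono power_le_one) auto
    then show ?thesis using assms by auto
  qed
  then show ?thesis by (auto simp: qfact_def)
qed

lemma filterlim_nat_int_add: "filterlim (\<lambda>n. nat (int n + k)) at_top sequentially"
  unfolding filterlim_at_top eventually_sequentially
proof
  fix Z
  show "\<exists>N. \<forall>n\<ge>N. Z \<le> nat (int n + k)"
    by (rule exI[of _ "nat (int Z + \<bar>k\<bar>)"]) auto
qed

text \<open>Let n tend to infinity in the finite identity. The coefficient at fixed \<open>k\<close>
  tends to 1/(Q; Q), and all coefficients share one bound, so limit and sum may be interchanged
  against the absolutely summable Gaussian terms.\<close>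

theorem triple_product:
  fixes q x :: complex
  assumes q: "norm q < 1" "q \<noteq> 0" and x: "x \<noteq> 0"
  shows "((\<lambda>k::int. q ^ nat (k ^ 2) * x powi k) has_sum
    qphi (q ^ 2) (q ^ 2) * qphi (q ^ 2) (- q * x) * qphi (q ^ 2) (- q / x)) UNIV"
proof -
  define Q where "Q = q ^ 2"
  define E where "E = qphi Q Q"
  have Q: "norm Q < 1" unfolding Q_def by (rule norm_square_less_1[OF q(1)])
  have E: "E \<noteq> 0" unfolding E_def by (rule qphi_nonzero'[OF Q Q])
  define f where "f = (\<lambda>k::int. q ^ nat (k ^ 2) * x powi k)"
  \<comment> \<open>Extension by 0 outside the finite range gives all the sums one common index
    set.\<close>
  define w where "w = (\<lambda>n (k::int). if k \<in> {- int n..int n} then qbin Q (2 * n) (nat (k + int n)) else 0)"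
  have w_eq: "w n k = qfact Q (2 * n) * (inverse (qfact Q (nat (int n + k))) * inverse (qfact Q (nat (int n - k))))"
    if "\<bar>k\<bar> \<le> int n" for n k
  proof -
    have "2 * n - nat (k + int n) = nat (int n - k)" using that by auto
    then have "w n k * qfact Q (nat (int n + k)) * qfact Q (nat (int n - k)) = qfact Q (2 * n)"
      using qbin_qfact[of "nat (k + int n)" "2 * n" Q] that by (auto simp: w_def add.commute)
    then show ?thesis using qfact_nonzero[OF Q] by (simp add: field_simps)
  qed
  have inv_lim: "(\<lambda>n. inverse (qfact Q n)) \<longlonglongrightarrow> inverse E"
    using E unfolding E_def by (intro tendsto_inverse qfact_LIMSEQ Q)
  obtain B where B: "\<And>n. norm (qfact Q n) \<le> B"
    using convergent_imp_Bseq[OF convergentI[OF qfact_LIMSEQ[OF Q]]] unfolding Bseq_def by auto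
  obtain B' where B': "\<And>n. norm (inverse (qfact Q n)) \<le> B'"
    using convergent_imp_Bseq[OF convergentI[OF inv_lim]] unfolding Bseq_def by auto
  have B0: "0 \<le> B" "0 \<le> B'" using B[of 0] B'[of 0] norm_ge_zero order.trans by blast+
  have w_bound: "norm (w n k) \<le> B * (B' * B')" for n k
  proof (cases "\<bar>k\<bar> \<le> int n")
    case True
    show ?thesis
      unfolding w_eq[OF True] norm_mult
      by (intro mult_mono B B') (auto simp: B0)
  next
    case False
    then have "w n k = 0" by (auto simp: w_def)
    then show ?thesis using B0 by simp
  qed
  have w_lim: "(\<lambda>n. w n k) \<longlonglongrightarrow> inverse E" for k
  proof (rule Lim_transform_eventually)
    have "(\<lambda>n. qfact Q (2 * n) * (inverse (qfact Q (nat (int n + k))) * inverse (qfact Q (nat (int n - k)))))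
        \<longlonglongrightarrow> E * (inverse E * inverse E)"
    proof (intro tendsto_mult)
      show "(\<lambda>n. qfact Q (2 * n)) \<longlonglongrightarrow> E"
        unfolding E_def by (rule filterlim_compose[OF qfact_LIMSEQ[OF Q] filterlim_subseq])
          (simp add: strict_mono_def)
      show "(\<lambda>n. inverse (qfact Q (nat (int n + k)))) \<longlonglongrightarrow> inverse E"
        by (rule filterlim_compose[OF inv_lim filterlim_nat_int_add])
      show "(\<lambda>n. inverse (qfact Q (nat (int n - k)))) \<longlonglongrightarrow> inverse E"
        using filterlim_compose[OF inv_lim filterlim_nat_int_add[of "- k"]] by simp
    qed
    moreover have "E * (inverse E * inverse E) = inverse E" using E by simp
    ultimately show "(\<lambda>n. qfact Q (2 * n) * (inverse (qfact Q (nat (int n + k))) * inverse (qfact Q (nat (int n - k)))))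
        \<longlonglongrightarrow> inverse E" by (simp only:)
    show "eventually (\<lambda>n. qfact Q (2 * n) * (inverse (qfact Q (nat (int n + k))) * inverse (qfact Q (nat (int n - k)))) = w n k) sequentially"
      using eventually_ge_at_top[of "nat \<bar>k\<bar>"] by eventually_elim (simp add: w_eq)
  qed
  \<comment> \<open>The integers are enumerated by \<open>int_decode\<close>, which turns the
    bilateral sums into ordinary series for Tannery's theorem.\<close>
  have f_sum: "summable (\<lambda>m. norm (f (int_decode m)))"
    using summable_on_reindex_bij_betw[OF bij_int_decode, of "\<lambda>k. norm (f k)"]
      theta_term_abs_summable[OF q(1) x]
    by (simp add: f_def summable_on_UNIV_nonneg_real_iff)
  have lim1: "(\<lambda>n. suminf (\<lambda>m. w n (int_decode m) * f (int_decode m))) \<longlonglongrightarrow> (suminf (\<lambda>m. inverse E * f (int_decode m)))"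
  proof (intro tannerys_theorem[THEN conjunct2, THEN conjunct2])
    show "(\<lambda>n. w n (int_decode m) * f (int_decode m)) \<longlonglongrightarrow> inverse E * f (int_decode m)" for m
      by (intro tendsto_mult w_lim tendsto_const)
    show "\<forall>\<^sub>F (m, n) in at_top \<times>\<^sub>F sequentially.
        norm (w n (int_decode m) * f (int_decode m)) \<le> B * (B' * B') * norm (f (int_decode m))"
      by (intro always_eventually) (auto simp: norm_mult intro!: mult_right_mono w_bound)
    show "summable (\<lambda>m. B * (B' * B') * norm (f (int_decode m)))"
      by (intro summable_mult f_sum)
  qed auto
  have "(suminf (\<lambda>m. w n (int_decode m) * f (int_decode m))) =
      (\<Prod>k<n. 1 - Q ^ k * (- q * x)) * (\<Prod>k<n. 1 - Q ^ k * (- q / x))" for n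
  proof -
    have "(suminf (\<lambda>m. w n (int_decode m) * f (int_decode m))) =
        (\<Sum>m\<in>int_encode ` {- int n..int n}. w n (int_decode m) * f (int_decode m))"
    proof (rule suminf_finite)
      fix m assume m: "m \<notin> int_encode ` {- int n..int n}"
      have "int_decode m \<notin> {- int n..int n}"
      proof
        assume "int_decode m \<in> {- int n..int n}"
        then have "int_encode (int_decode m) \<in> int_encode ` {- int n..int n}" by (rule imageI)
        then show False using m by simp
      qed
      then show "w n (int_decode m) * f (int_decode m) = 0" unfolding w_def by (simp only: if_False mult_zero_left)
    qed auto
    also have "\<dots> = (\<Sum>k\<in>{- int n..int n}. w n k * f k)"
      by (subst sum.reindex) (auto intro: inj_on_subset[OF inj_int_encode])
    also have "\<dots> = (\<Sum>k\<in>{- int n..int n}. qbin Q (2 * n) (nat (k + int n)) * q ^ nat (k ^ 2) * x powi k)"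
      by (intro sum.cong refl) (simp add: w_def f_def)
    also have "\<dots> = (\<Prod>k<n. 1 + Q ^ k * (q * x)) * (\<Prod>k<n. 1 + Q ^ k * (q / x))"
      unfolding Q_def by (rule finite_triple_product[OF q(2) x, symmetric])
    finally show ?thesis by simp
  qed
  then have "(\<lambda>n. suminf (\<lambda>m. w n (int_decode m) * f (int_decode m))) \<longlonglongrightarrow> qphi Q (- q * x) * qphi Q (- q / x)"
    by (simp only:) (intro tendsto_mult qphi_LIMSEQ Q)
  then have "qphi Q (- q * x) * qphi Q (- q / x) = (suminf (\<lambda>m. inverse E * f (int_decode m)))"
    using lim1 LIMSEQ_unique by blast
  also have "\<dots> = inverse E * (suminf (\<lambda>m. f (int_decode m)))"
    by (rule suminf_mult[OF summable_norm_cancel[OF f_sum]])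
  finally have "(suminf (\<lambda>m. f (int_decode m))) = E * qphi Q (- q * x) * qphi Q (- q / x)"
    using E by (simp add: field_simps)
  moreover have "(\<lambda>m. f (int_decode m)) sums (suminf (\<lambda>m. f (int_decode m)))"
    by (rule summable_sums[OF summable_norm_cancel[OF f_sum]])
  ultimately have "((\<lambda>m. f (int_decode m)) has_sum E * qphi Q (- q * x) * qphi Q (- q / x)) UNIV"
    using norm_summable_imp_has_sum[OF f_sum] by simp
  then have "(f has_sum E * qphi Q (- q * x) * qphi Q (- q / x)) UNIV"
    using has_sum_reindex_bij_betw[OF bij_int_decode] by blast
  then show ?thesis by (simp add: f_def E_def Q_def)
qed

section \<open>Theta constants as infinite products\<close>

lemma theta3_product:
  fixes z \<tau> :: complex
  assumes "Im \<tau> > 0"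
  defines "q \<equiv> exp (of_real pi * \<i> * \<tau>)" and "x \<equiv> exp (2 * of_real pi * \<i> * z)"
  shows "theta3 z \<tau> = qphi (q ^ 2) (q ^ 2) * qphi (q ^ 2) (- q * x) * qphi (q ^ 2) (- q / x)"
proof -
  have "norm q < 1" using assms(1) by (simp add: q_def)
  then have "((\<lambda>k::int. q ^ nat (k ^ 2) * x powi k) has_sum
    qphi (q ^ 2) (q ^ 2) * qphi (q ^ 2) (- q * x) * qphi (q ^ 2) (- q / x)) UNIV"
    by (intro triple_product) (auto simp: q_def x_def)
  moreover have "exp (of_real pi * \<i> * of_int k ^ 2 * \<tau> + 2 * of_real pi * \<i> * of_int k * z) =
      q ^ nat (k ^ 2) * x powi k" for k :: int
  proof -
    have "x powi k = exp (of_int k * (2 * of_real pi * \<i> * z))"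
      unfolding x_def by (rule exp_power_int)
    moreover have "q ^ nat (k ^ 2) = exp (of_nat (nat (k ^ 2)) * (of_real pi * \<i> * \<tau>))"
      unfolding q_def by (rule exp_of_nat_mult[symmetric])
    moreover have "(of_nat (nat (k ^ 2)) :: complex) = of_int k ^ 2"
      by (simp flip: of_int_power)
    ultimately show ?thesis by (simp add: exp_add mult_ac)
  qed
  ultimately show ?thesis unfolding theta3_def by (simp add: infsumI)
qed

text \<open>Besides exp(pi i \<tau>/4), a factor 2 and three copies of (q^2; q^2), the constants
  contribute exactly the squares of the three factors in Euler's identity. The eighth power turns
  the exponential into q^2.\<close>

lemma theta_product_power8:
  assumes "Im \<tau> > 0"
  defines "q \<equiv> exp (of_real pi * \<i> * \<tau>)"
  shows "(theta2 0 \<tau> * theta3 0 \<tau> * theta4 0 \<tau>) ^ 8 = 2 ^ 8 * q ^ 2 * qphi (q ^ 2) (q ^ 2) ^ 24"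
proof -
  have q: "norm q < 1" "q \<noteq> 0" using assms(1) by (simp_all add: q_def)
  have Q: "norm (q ^ 2) < 1" by (rule norm_square_less_1[OF q(1)])
  define E where "E = qphi (q ^ 2) (q ^ 2)"
  have t3: "theta3 0 \<tau> = E * qphi (q ^ 2) (- q) ^ 2"
    using theta3_product[OF assms(1), of 0] by (simp add: q_def E_def power2_eq_square)
  have "exp (of_real pi * \<i>) = -1" by (rule exp_pi_i)
  then have t4: "theta4 0 \<tau> = E * qphi (q ^ 2) q ^ 2"
    using theta3_product[OF assms(1), of "1/2"] 
    by (simp add: theta4_def q_def E_def power2_eq_square)
  have "theta3 (\<tau> / 2) \<tau> = E * qphi (q ^ 2) (- q * q) * qphi (q ^ 2) (- q / q)"
    using theta3_product[OF assms(1), of "\<tau>/2"] by (simp add: q_def E_def mult.assoc)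
  \<comment> \<open>The product at -1 begins with the factor 1 - (-1) = 2.\<close>
  also have "qphi (q ^ 2) (- q / q) = 2 * qphi (q ^ 2) (- (q ^ 2))"
    using qphi_step[OF Q, of "-1"] q by simp
  finally have t2: "theta2 0 \<tau> = exp (of_real pi * \<i> * \<tau> / 4) * E * 2 * qphi (q ^ 2) (- (q ^ 2)) ^ 2"
    by (simp add: theta2_def power2_eq_square)
  have "theta2 0 \<tau> * theta3 0 \<tau> * theta4 0 \<tau> = exp (of_real pi * \<i> * \<tau> / 4) * 2 * E ^ 3 *
      (qphi (q ^ 2) (- (q ^ 2)) * qphi (q ^ 2) q * qphi (q ^ 2) (- q)) ^ 2"
    unfolding t2 t3 t4 by (simp add: power2_eq_square power3_eq_cube mult_ac)
  also have "\<dots> = exp (of_real pi * \<i> * \<tau> / 4) * 2 * E ^ 3"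
    unfolding qphi_euler[OF q(1)] by simp
  finally have "(theta2 0 \<tau> * theta3 0 \<tau> * theta4 0 \<tau>) ^ 8 = exp (of_real pi * \<i> * \<tau> / 4) ^ 8 * 2 ^ 8 * E ^ 24"
    by (simp add: power_mult_distrib power_mult[symmetric])
  also have "exp (of_real pi * \<i> * \<tau> / 4) ^ 8 = q ^ 2"
    unfolding q_def exp_of_nat_mult[symmetric] by (simp add: exp_double[symmetric] mult_ac)
  finally show ?thesis by (simp add: E_def mult_ac)
qed

section \<open>The Weierstrass function of a lattice\<close>

lemma lattice_unit: "lattice 1 \<tau> = {of_int m + of_int n * \<tau> | m n. True}"
  by (simp add: lattice_def)

text \<open>Periods are normalized to 1 and \<tau>; \<open>weierstrass_P_scale\<close> reintroduces
  \<open>\<omega>\<^sub>1\<close>.\<close>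

locale upper_half_plane =
  fixes \<tau> :: complex
  assumes Im_tau: "Im \<tau> > 0"
begin

abbreviation "L \<equiv> lattice 1 \<tau>"

lemma L_zero [simp, intro]: "0 \<in> L"
  unfolding lattice_unit mem_Collect_eq by (rule exI[of _ 0], rule exI[of _ 0]) simp

lemma L_one [simp, intro]: "1 \<in> L"
  unfolding lattice_unit mem_Collect_eq by (rule exI[of _ 1], rule exI[of _ 0]) simp

lemma L_tau [simp, intro]: "\<tau> \<in> L"
  unfolding lattice_unit mem_Collect_eq by (rule exI[of _ 0], rule exI[of _ 1]) simp

lemma L_add: "a \<in> L \<Longrightarrow> b \<in> L \<Longrightarrow> a + b \<in> L"
  unfolding lattice_unit mem_Collect_eq
proof (elim exE conjE)
  fix m n m' n' assume "a = of_int m + of_int n * \<tau>" "b = of_int m' + of_int n' * \<tau>"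
  then have "a + b = of_int (m + m') + of_int (n + n') * \<tau>" by (simp add: algebra_simps)
  then show "\<exists>m n. a + b = of_int m + of_int n * \<tau> \<and> True" by blast
qed

lemma L_uminus: "a \<in> L \<Longrightarrow> - a \<in> L"
  unfolding lattice_unit mem_Collect_eq
proof (elim exE conjE)
  fix m n assume "a = of_int m + of_int n * \<tau>"
  then have "- a = of_int (- m) + of_int (- n) * \<tau>" by simp
  then show "\<exists>m n. - a = of_int m + of_int n * \<tau> \<and> True" by blast
qed

lemma L_diff: "a \<in> L \<Longrightarrow> b \<in> L \<Longrightarrow> a - b \<in> L"
  using L_add[of a "- b"] L_uminus by simp

lemma L_add_iff: "b \<in> L \<Longrightarrow> a + b \<in> L \<longleftrightarrow> a \<in> L"
  using L_add[of a b] L_diff[of "a + b" b] by auto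

text \<open>The imaginary part n Im \<tau> bounds \<open>n\<close>, and then m = z - n \<tau> is
  bounded as well. Discreteness and the convergence of lattice sums both rest on this.\<close>

lemma lattice_norm_bound:
  obtains K where "K > 0" "\<And>m n. real_of_int (\<bar>m\<bar> + \<bar>n\<bar>) \<le> K * norm (of_int m + of_int n * \<tau>)"
proof
  define K where "K = 1 + (norm \<tau> + 1) / Im \<tau>"
  show "K > 0" using Im_tau by (auto simp: K_def intro!: add_pos_nonneg)
  fix m n :: int
  define z where "z = of_int m + of_int n * \<tau>"
  have "\<bar>of_int n * Im \<tau>\<bar> \<le> norm z"
    using abs_Im_le_cmod[of z] by (simp add: z_def)
  then have n: "\<bar>real_of_int n\<bar> \<le> norm z / Im \<tau>"
    using Im_tau by (simp add: abs_mult field_simps)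
  have "of_int m = z - of_int n * \<tau>" by (simp add: z_def)
  then have "norm (of_int m :: complex) \<le> norm z + norm (of_int n * \<tau>)"
    using norm_triangle_ineq4 by metis
  then have "\<bar>real_of_int m\<bar> \<le> norm z + \<bar>real_of_int n\<bar> * norm \<tau>"
    by (simp add: norm_mult)
  also have "\<dots> \<le> norm z + norm z / Im \<tau> * norm \<tau>"
    using n by (intro add_left_mono mult_right_mono) auto
  finally show "real_of_int (\<bar>m\<bar> + \<bar>n\<bar>) \<le> K * norm (of_int m + of_int n * \<tau>)"
    using n unfolding z_def[symmetric] K_def by (simp add: algebra_simps add_divide_distrib)
qed

lemma of_int_add_mult_tau_inj: "inj (\<lambda>(m, n). of_int m + of_int n * \<tau> :: complex)"
proof (rule injI, clarify)
  fix m n m' n' :: int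
  assume eq: "of_int m + of_int n * \<tau> = of_int m' + of_int n' * \<tau>"
  then have "Im (of_int m + of_int n * \<tau>) = Im (of_int m' + of_int n' * \<tau>)" by simp
  then have "n = n'" using Im_tau by simp
  then show "m = m' \<and> n = n'" using eq by simp
qed

lemma L_eq_range: "L = range (\<lambda>(m, n). of_int m + of_int n * \<tau>)"
  unfolding lattice_unit by auto

lemma finite_L_ball: "finite {\<omega> \<in> L. norm \<omega> \<le> r}"
proof -
  obtain K where K: "K > 0" "\<And>m n. real_of_int (\<bar>m\<bar> + \<bar>n\<bar>) \<le> K * norm (of_int m + of_int n * \<tau>)"
    by (rule lattice_norm_bound) auto
  define N where "N = \<lceil>K * r\<rceil>"
  have "{\<omega> \<in> L. norm \<omega> \<le> r} \<subseteq> (\<lambda>(m, n). of_int m + of_int n * \<tau>) ` ({-N..N} \<times> {-N..N})"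
  proof clarify
    fix \<omega> assume "\<omega> \<in> L" and r: "norm \<omega> \<le> r"
    then obtain m n where w: "\<omega> = of_int m + of_int n * \<tau>" by (auto simp: lattice_unit)
    have "real_of_int (\<bar>m\<bar> + \<bar>n\<bar>) \<le> K * norm \<omega>" using K(2) w by simp
    also have "\<dots> \<le> K * r" using r K(1) by (intro mult_left_mono) auto
    finally have "\<bar>m\<bar> + \<bar>n\<bar> \<le> N" unfolding N_def by linarith
    then show "\<omega> \<in> (\<lambda>(m, n). of_int m + of_int n * \<tau>) ` ({-N..N} \<times> {-N..N})"
      unfolding w by (intro image_eqI[of _ _ "(m, n)"]) auto
  qed
  then show ?thesis by (rule finite_subset) auto
qed

lemma summable_int_powr: "(\<lambda>m::int. (1 + \<bar>real_of_int m\<bar>) powr (-3/2)) summable_on UNIV"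
proof -
  let ?f = "\<lambda>m::int. (1 + \<bar>real_of_int m\<bar>) powr (-3/2)"
  have "summable (\<lambda>n. of_nat (Suc n) powr (-3/2) :: real)"
    by (subst summable_Suc_iff, subst summable_real_powr_iff) simp
  then have s: "summable (\<lambda>n. (1 + real n) powr (-3/2))" by simp
  show ?thesis using s by (intro summable_on_int_nonneg) auto
qed

text \<open>Since (1 + |m|)(1 + |n|) \<le> (1 + |m| + |n|)^2, the inverse cube is dominated by a
  product of two single terms with exponent -3/2, each summable. The term at 0 is 0 because 1/0 =
  0.\<close>

lemma summable_lattice_cube: "(\<lambda>\<omega>. 1 / norm \<omega> ^ 3) summable_on L"
proof -
  obtain K where K: "K > 0" "\<And>m n. real_of_int (\<bar>m\<bar> + \<bar>n\<bar>) \<le> K * norm (of_int m + of_int n * \<tau>)"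
    by (rule lattice_norm_bound) auto
  define h where "h = (\<lambda>m::int. (1 + \<bar>real_of_int m\<bar>) powr (-3/2))"
  have h: "h summable_on UNIV" unfolding h_def by (rule summable_int_powr)
  have "(\<lambda>(m, n). h m * h n) summable_on (UNIV \<times> UNIV)"
  proof (rule summable_on_SigmaI)
    show "((\<lambda>n. case (m, n) of (m, n) \<Rightarrow> h m * h n) has_sum h m * infsum h UNIV) UNIV" for m
      using has_sum_cmult_right[OF has_sum_infsum[OF h], of "h m"] by simp
    show "(\<lambda>m. h m * infsum h UNIV) summable_on UNIV"
      by (rule summable_on_cmult_left[OF h])
  qed (auto simp: h_def)
  then have "(\<lambda>x. (2 * K) ^ 3 * (case x of (m, n) \<Rightarrow> h m * h n)) summable_on UNIV"
    by (intro summable_on_cmult_right) simp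
  then have "(\<lambda>(m, n). 1 / norm (of_int m + of_int n * \<tau>) ^ 3) summable_on UNIV"
  proof (rule summable_on_comparison_test)
    fix x :: "int \<times> int"
    obtain m n where x: "x = (m, n)" by fastforce
    let ?w = "of_int m + of_int n * \<tau>"
    let ?a = "1 + \<bar>real_of_int m\<bar>" and ?b = "1 + \<bar>real_of_int n\<bar>"
    have "1 / norm ?w ^ 3 \<le> (2 * K) ^ 3 * (h m * h n)"
    proof (cases "m = 0 \<and> n = 0")
      case False
      then have "1 \<le> \<bar>m\<bar> + \<bar>n\<bar>" by linarith
      then have "1 \<le> real_of_int (\<bar>m\<bar> + \<bar>n\<bar>)" by linarith
      then have "1 + \<bar>real_of_int m\<bar> + \<bar>real_of_int n\<bar> \<le> 2 * real_of_int (\<bar>m\<bar> + \<bar>n\<bar>)" by simp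
      also have "\<dots> \<le> 2 * (K * norm ?w)" using K(2)[of m n] by simp
      finally have 1: "1 + \<bar>real_of_int m\<bar> + \<bar>real_of_int n\<bar> \<le> 2 * K * norm ?w" by simp
      have "?a * ?b \<le> (1 + \<bar>real_of_int m\<bar> + \<bar>real_of_int n\<bar>) ^ 2"
        by (simp add: power2_eq_square algebra_simps)
      also have "\<dots> \<le> (2 * K * norm ?w) ^ 2" using 1 by (intro power_mono) auto
      finally have "(?a * ?b) powr (3/2) \<le> ((2 * K * norm ?w) ^ 2) powr (3/2)"
        by (intro powr_mono2) auto
      also have "\<dots> = (2 * K * norm ?w) ^ 3"
      proof -
        have "2 * K * norm ?w > 0" using 1 by linarith
        then show ?thesis
          by (simp add: powr_powr flip: powr_numeral)
      qed
      finally have 2: "?a powr (3/2) * ?b powr (3/2) \<le> (2 * K) ^ 3 * norm ?w ^ 3"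
        by (simp add: powr_mult power_mult_distrib)
      have pos: "norm ?w > 0" using 1 K(1) by (auto simp: zero_less_mult_iff intro: ccontr)
      have "h m * h n = 1 / (?a powr (3/2) * ?b powr (3/2))"
        by (simp add: h_def powr_minus divide_simps)
      moreover have "0 < ?a powr (3/2) * ?b powr (3/2)" by simp
      moreover have "1 / W \<le> Y * (1 / X)" if "0 < X" "0 < W" "X \<le> Y * W" for X W Y :: real
        using that by (simp add: field_simps)
      ultimately show ?thesis using 2 pos by simp
    qed (use K(1) in \<open>simp add: h_def\<close>)
    then show "(case x of (m, n) \<Rightarrow> 1 / norm (of_int m + of_int n * \<tau>) ^ 3) \<le>
      (2 * K) ^ 3 * (case x of (m, n) \<Rightarrow> h m * h n)" by (simp add: x)
  qed auto
  then show ?thesis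
    unfolding L_eq_range
    by (subst summable_on_reindex[OF of_int_add_mult_tau_inj]) (simp add: o_def case_prod_unfold)
qed

section \<open>The Weierstrass series: convergence, parity, periods, poles\<close>

definition wp_term :: "complex \<Rightarrow> complex \<Rightarrow> complex" where
  "wp_term z \<omega> = 1 / (z + \<omega>) ^ 2 - 1 / \<omega> ^ 2"

text \<open>The difference equals -z(2\<omega> + z) / (\<omega>^2 (z + \<omega>)^2). Here |z +
  \<omega>| is at least |\<omega>|/2 and |2\<omega> + z| at most (5/2)|\<omega>|, and 10 = 4 *
  5/2.\<close>

lemma wp_term_bound:
  assumes "norm z \<le> r" "2 * r < norm \<omega>"
  shows "norm (wp_term z \<omega>) \<le> 10 * r * (1 / norm \<omega> ^ 3)"
proof -
  have r0: "0 \<le> r" using assms(1) norm_ge_zero order.trans by blast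
  then have w0: "norm \<omega> > 0" using assms(2) by linarith
  have "norm \<omega> \<le> norm (z + \<omega>) + norm z" using norm_triangle_ineq4[of "z + \<omega>" z] by simp
  then have zw: "norm \<omega> / 2 \<le> norm (z + \<omega>)" using assms by linarith
  then have zw0: "z + \<omega> \<noteq> 0" using w0 by auto
  have w00: "\<omega> \<noteq> 0" using w0 by auto
  have "wp_term z \<omega> = - (z * (2 * \<omega> + z)) / (\<omega> ^ 2 * (z + \<omega>) ^ 2)"
    using zw0 w00 by (simp add: wp_term_def divide_simps) (simp add: power2_eq_square algebra_simps)
  then have "norm (wp_term z \<omega>) = norm z * norm (2 * \<omega> + z) / (norm \<omega> ^ 2 * norm (z + \<omega>) ^ 2)"
    by (simp add: norm_divide norm_mult norm_power)
  also have "\<dots> \<le> r * (5 / 2 * norm \<omega>) / (norm \<omega> ^ 2 * (norm \<omega> / 2) ^ 2)"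
  proof (intro frac_le mult_mono power_mono zw assms(1))
    have "norm (2 * \<omega> + z) \<le> 2 * norm \<omega> + norm z" using norm_triangle_ineq[of "2 * \<omega>" z] by (simp add: norm_mult)
    then show "norm (2 * \<omega> + z) \<le> 5 / 2 * norm \<omega>" using assms by linarith
  qed (use w0 r0 in auto)
  also have "\<dots> = 10 * r * (1 / norm \<omega> ^ 3)"
    using w0 by (simp add: field_simps power2_eq_square power3_eq_cube)
  finally show ?thesis .
qed

text \<open>The sum runs over the whole lattice: as 1/0 = 0, the term at 0 is exactly 1/z^2, and
  translations act on the full index set. At lattice points the value is a convention.\<close>

definition wp :: "complex \<Rightarrow> complex" where "wp z = infsum (wp_term z) L"

lemma wp_term_abs_summable: "(\<lambda>\<omega>. norm (wp_term z \<omega>)) summable_on (L - {\<omega>. norm \<omega> \<le> 2 * norm z})"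
proof (rule summable_on_comparison_test)
  show "(\<lambda>\<omega>. 10 * norm z * (1 / norm \<omega> ^ 3)) summable_on (L - {\<omega>. norm \<omega> \<le> 2 * norm z})"
    by (intro summable_on_cmult_right summable_on_subset_banach[OF summable_lattice_cube]) auto
  show "norm (wp_term z \<omega>) \<le> 10 * norm z * (1 / norm \<omega> ^ 3)"
    if "\<omega> \<in> L - {\<omega>. norm \<omega> \<le> 2 * norm z}" for \<omega>
    using that by (intro wp_term_bound) auto
qed auto

lemma wp_term_summable: "wp_term z summable_on L"
proof -
  have "wp_term z summable_on (L - {\<omega>. norm \<omega> \<le> 2 * norm z})"
    by (rule abs_summable_summable[OF wp_term_abs_summable])
  moreover have "wp_term z summable_on {\<omega> \<in> L. norm \<omega> \<le> 2 * norm z}"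
    by (rule summable_on_finite[OF finite_L_ball])
  ultimately have "wp_term z summable_on ((L - {\<omega>. norm \<omega> \<le> 2 * norm z}) \<union> {\<omega> \<in> L. norm \<omega> \<le> 2 * norm z})"
    by (rule summable_on_Un_disjoint) auto
  moreover have "(L - {\<omega>. norm \<omega> \<le> 2 * norm z}) \<union> {\<omega> \<in> L. norm \<omega> \<le> 2 * norm z} = L" by auto
  ultimately show ?thesis by simp
qed

lemma weierstrass_P_eq_wp: "weierstrass_P L z = wp z"
proof -
  have "wp z = infsum (wp_term z) (insert 0 (L - {0}))"
    unfolding wp_def by (simp add: insert_absorb)
  also have "\<dots> = wp_term z 0 + infsum (wp_term z) (L - {0})"
    by (rule infsum_insert) (auto intro: summable_on_subset_banach[OF wp_term_summable])
  finally show ?thesis by (simp add: weierstrass_P_def wp_term_def[abs_def])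
qed

lemma wp_uminus: "wp (- z) = wp z"
  unfolding wp_def
proof (rule infsum_reindex_bij_witness[of _ uminus uminus])
  fix \<omega>
  show "wp_term z (- \<omega>) = wp_term (- z) \<omega>"
  proof -
    have "(z - \<omega>) ^ 2 = (\<omega> - z) ^ 2" by (simp add: power2_commute)
    then show ?thesis by (simp add: wp_term_def)
  qed
qed (auto simp: L_uminus)

text \<open>The corrections 1/\<omega>^2 cancel in a difference, which makes it visibly invariant
  under shifting the index.\<close>

lemma wp_diff: "wp z - wp w = infsum (\<lambda>\<omega>. 1 / (z + \<omega>) ^ 2 - 1 / (w + \<omega>) ^ 2) L"
proof -
  have "(\<lambda>\<omega>. - wp_term w \<omega>) summable_on L"
    unfolding summable_on_uminus by (rule wp_term_summable)
  then have "infsum (\<lambda>\<omega>. wp_term z \<omega> + - wp_term w \<omega>) L = wp z + - wp w"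
    unfolding wp_def infsum_uminus[symmetric] by (rule infsum_add[OF wp_term_summable])
  then show ?thesis by (simp add: wp_term_def)
qed

text \<open>The increment \<open>wp (z + l) - wp z\<close> does not depend on \<open>z\<close>, and
  at \<open>z = - l / 2\<close> it vanishes by evenness.\<close>

lemma wp_periodic:
  assumes "l \<in> L"
  shows "wp (z + l) = wp z"
proof -
  have shift: "wp (z + l) - wp (w + l) = wp z - wp w" for z w
    unfolding wp_diff
    by (rule infsum_reindex_bij_witness[of _ "\<lambda>\<omega>. \<omega> - l" "\<lambda>\<omega>. \<omega> + l"])
      (auto simp: assms L_add L_diff algebra_simps)
  have "wp (z + l) - wp (- l / 2 + l) = wp z - wp (- l / 2)" by (rule shift)
  moreover have "- l / 2 + l = l / 2" by simp
  moreover have "wp (- l / 2) = wp (l / 2)" using wp_uminus[of "l/2"] by simp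
  ultimately show ?thesis by simp
qed

text \<open>Only finitely many lattice points have norm at most 2r. The other terms have no pole in
  the closed disc and converge uniformly there by the M-test.\<close>

lemma wp_split:
  assumes "r > 0"
  obtains g where "g holomorphic_on ball 0 r"
    "\<And>z. z \<in> ball 0 r \<Longrightarrow> wp z = (\<Sum>\<omega>\<in>{\<omega> \<in> L. norm \<omega> \<le> 2 * r}. wp_term z \<omega>) + g z"
proof
  define F where "F = {\<omega> \<in> L. norm \<omega> \<le> 2 * r}"
  define g where "g = (\<lambda>z. infsum (wp_term z) (L - F))"
  have finF: "finite F" unfolding F_def by (rule finite_L_ball)
  have big: "2 * r < norm \<omega>" if "\<omega> \<in> L - F" for \<omega> using that by (auto simp: F_def)
  have ul: "uniform_limit (cball 0 r) (\<lambda>X z. \<Sum>\<omega>\<in>X. wp_term z \<omega>) (\<lambda>z. infsum (wp_term z) (L - F)) (finite_subsets_at_top (L - F))"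
  proof (rule Weierstrass_m_test_general[where M = "\<lambda>\<omega>. 10 * r * (1 / norm \<omega> ^ 3)"])
    show "(\<lambda>\<omega>. 10 * r * (1 / norm \<omega> ^ 3)) summable_on (L - F)"
      by (intro summable_on_cmult_right summable_on_subset_banach[OF summable_lattice_cube]) auto
  qed (use big in \<open>auto intro!: wp_term_bound simp del: times_divide_eq_right\<close>)
  have ev: "\<forall>\<^sub>F X in finite_subsets_at_top (L - F). continuous_on (cball 0 r) (\<lambda>z. \<Sum>\<omega>\<in>X. wp_term z \<omega>) \<and>
      (\<lambda>z. \<Sum>\<omega>\<in>X. wp_term z \<omega>) holomorphic_on ball 0 r"
  proof (rule eventually_finite_subsets_at_top_weakI)
    fix X assume X: "finite X" "X \<subseteq> L - F"
    have "z + \<omega> \<noteq> 0" if "z \<in> cball 0 r" "\<omega> \<in> X" for z \<omega>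
    proof
      assume "z + \<omega> = 0"
      then have "\<omega> = - z" by (simp add: add_eq_0_iff)
      then have "norm \<omega> \<le> r" using that by simp
      then show False using big[of \<omega>] X that assms by auto
    qed
    then have "(\<lambda>z. \<Sum>\<omega>\<in>X. wp_term z \<omega>) holomorphic_on cball 0 r"
      unfolding wp_term_def by (intro holomorphic_intros) auto
    then show "continuous_on (cball 0 r) (\<lambda>z. \<Sum>\<omega>\<in>X. wp_term z \<omega>) \<and>
        (\<lambda>z. \<Sum>\<omega>\<in>X. wp_term z \<omega>) holomorphic_on ball 0 r"
      using holomorphic_on_imp_continuous_on holomorphic_on_subset ball_subset_cball by blast
  qed
  show "g holomorphic_on ball 0 r"
    unfolding g_def by (rule holomorphic_uniform_limit[OF ev ul]) auto
  show "wp z = (\<Sum>\<omega>\<in>{\<omega> \<in> L. norm \<omega> \<le> 2 * r}. wp_term z \<omega>) + g z" for z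
  proof -
    have "wp z = infsum (wp_term z) (F \<union> (L - F))"
      unfolding wp_def by (rule arg_cong[of _ _ "infsum _"]) (auto simp: F_def)
    also have "\<dots> = infsum (wp_term z) F + infsum (wp_term z) (L - F)"
      by (rule infsum_Un_disjoint) (auto intro: summable_on_subset_banach[OF wp_term_summable] simp: F_def finF)
    finally show ?thesis using finF by (simp add: F_def g_def)
  qed
qed

lemma discrete_L:
  obtains d where "d > 0" "\<And>\<omega>. \<omega> \<in> L \<Longrightarrow> norm \<omega> < d \<Longrightarrow> \<omega> = 0"
proof -
  have fin: "finite ({\<omega> \<in> L. norm \<omega> \<le> 1} - {0})" using finite_L_ball by blast
  define d where "d = Min (insert 1 (norm ` ({\<omega> \<in> L. norm \<omega> \<le> 1} - {0})))"
  show thesis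
  proof
    show "d > 0" unfolding d_def using fin by (subst Min_gr_iff) auto
    fix \<omega> assume w: "\<omega> \<in> L" "norm \<omega> < d"
    have "d \<le> 1" unfolding d_def using fin by (intro Min_le) auto
    show "\<omega> = 0"
    proof (rule ccontr)
      assume "\<omega> \<noteq> 0"
      then have "d \<le> norm \<omega>" unfolding d_def using fin w \<open>d \<le> 1\<close> by (intro Min_le) auto
      then show False using w by simp
    qed
  qed
qed

lemma wp_near_0:
  obtains r g where "r > 0" "\<And>\<omega>. \<omega> \<in> L \<Longrightarrow> norm \<omega> < r \<Longrightarrow> \<omega> = 0" "g holomorphic_on ball 0 r"
    "\<And>z. z \<in> ball 0 r \<Longrightarrow> wp z = 1 / z ^ 2 + g z"
proof -
  obtain d where d: "d > 0" "\<And>\<omega>. \<omega> \<in> L \<Longrightarrow> norm \<omega> < d \<Longrightarrow> \<omega> = 0" by (rule discrete_L) auto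
  obtain g where g: "g holomorphic_on ball 0 (d / 3)"
    "\<And>z. z \<in> ball 0 (d / 3) \<Longrightarrow> wp z = (\<Sum>\<omega>\<in>{\<omega> \<in> L. norm \<omega> \<le> 2 * (d / 3)}. wp_term z \<omega>) + g z"
    using wp_split[of "d / 3"] d(1) by auto
  \<comment> \<open>The radius d/3 gives 2 * (d/3) < d, so only the pole at 0 is left.\<close>
  have "{\<omega> \<in> L. norm \<omega> \<le> 2 * (d / 3)} = {0}"
    using d by force
  then have "wp z = 1 / z ^ 2 + g z" if "z \<in> ball 0 (d / 3)" for z
    using g(2)[OF that] by (simp add: wp_term_def)
  then show thesis using that[of "d / 3" g] d g(1) by auto
qed

lemma open_minus_L: "open (- L)"
  unfolding open_dist
proof
  fix z assume z: "z \<in> - L"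
  obtain d where d: "d > 0" "\<And>\<omega>. \<omega> \<in> L \<Longrightarrow> norm \<omega> < d \<Longrightarrow> \<omega> = 0" by (rule discrete_L) auto
  have fin: "finite {\<omega> \<in> L. norm \<omega> \<le> norm z + 1}" by (rule finite_L_ball)
  have "open (- {\<omega> \<in> L. norm \<omega> \<le> norm z + 1})"
    using finite_imp_closed[OF fin] by (simp add: open_Compl)
  then obtain e where e: "e > 0" "\<And>y. dist y z < e \<Longrightarrow> y \<in> - {\<omega> \<in> L. norm \<omega> \<le> norm z + 1}"
    using z unfolding open_dist by auto
  show "\<exists>e>0. \<forall>y. dist y z < e \<longrightarrow> y \<in> - L"
  proof (intro exI[of _ "min e 1"] conjI allI impI)
    fix y assume y: "dist y z < min e 1"
    have "norm y \<le> norm z + norm (y - z)" using norm_triangle_ineq[of z "y - z"] by simp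
    then have "norm y \<le> norm z + 1" using y by (simp add: dist_norm)
    then show "y \<in> - L" using e(2)[of y] y by auto
  qed (use e in auto)
qed

lemma wp_differentiable:
  assumes "z \<notin> L"
  shows "wp field_differentiable (at z)"
proof -
  have pos: "norm z + 1 > 0" by (simp add: add_nonneg_pos)
  obtain g where g: "g holomorphic_on ball 0 (norm z + 1)"
    "\<And>w. w \<in> ball 0 (norm z + 1) \<Longrightarrow>
      wp w = (\<Sum>\<omega>\<in>{\<omega> \<in> L. norm \<omega> \<le> 2 * (norm z + 1)}. wp_term w \<omega>) + g w"
    by (rule wp_split[OF pos]) (rule that)
  let ?S = "ball 0 (norm z + 1) - L"
  have S: "open ?S" using open_minus_L by (simp add: Diff_eq open_Int)
  have "(\<lambda>w. (\<Sum>\<omega>\<in>{\<omega> \<in> L. norm \<omega> \<le> 2 * (norm z + 1)}. wp_term w \<omega>) + g w) holomorphic_on ?S"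
  proof (intro holomorphic_on_add holomorphic_on_subset[OF g(1)] holomorphic_on_sum)
    fix \<omega> assume "\<omega> \<in> {\<omega> \<in> L. norm \<omega> \<le> 2 * (norm z + 1)}"
    then have "w + \<omega> \<noteq> 0" if "w \<in> ?S" for w
      using that L_uminus[of \<omega>] by (auto simp: add_eq_0_iff2)
    then show "(\<lambda>w. wp_term w \<omega>) holomorphic_on ?S"
      unfolding wp_term_def by (intro holomorphic_intros) auto
  qed auto
  then have "wp holomorphic_on ?S"
    by (rule holomorphic_transform) (use g(2) in auto)
  then show ?thesis
    using S assms by (intro holomorphic_on_imp_differentiable_at[of wp ?S]) auto
qed

end

section \<open>Differences of Weierstrass values as products\<close>

text \<open>On a closed disc of radius 1 the deviations of the factors from 1 have a geometric
  majorant, so the partial products converge uniformly.\<close>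

lemma qphi_holomorphic:
  assumes "norm Q < 1"
  shows "qphi Q holomorphic_on UNIV"
proof (rule holomorphic_uniform_sequence)
  show "(\<lambda>x. \<Prod>k<n. 1 - Q ^ k * x) holomorphic_on UNIV" for n
    by (intro holomorphic_intros)
  fix x :: complex
  define B where "B = norm x + 1"
  have "uniformly_convergent_on (cball x 1) (\<lambda>n x. \<Sum>k<n. norm ((1 - Q ^ k * x) - 1))"
  proof (rule Weierstrass_m_test')
    show "norm (norm ((1 - Q ^ k * y) - 1)) \<le> norm Q ^ k * B" if "y \<in> cball x 1" for k y
    proof -
      have "norm y \<le> norm x + norm (y - x)" using norm_triangle_ineq[of x "y - x"] by simp
      then have "norm y \<le> B" using that by (simp add: B_def dist_norm norm_minus_commute)
      then show ?thesis by (simp add: norm_mult norm_power mult_left_mono)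
    qed
    show "summable (\<lambda>k. norm Q ^ k * B)"
      using assms by (intro summable_mult2 summable_geometric) auto
  qed
  then have "uniformly_convergent_on (cball x 1) (\<lambda>n x. \<Prod>k<n. 1 - Q ^ k * x)"
    by (intro uniformly_convergent_on_prod') (auto intro!: continuous_intros)
  then obtain l where l: "uniform_limit (cball x 1) (\<lambda>n x. \<Prod>k<n. 1 - Q ^ k * x) l sequentially"
    unfolding uniformly_convergent_on_def by blast
  have "l y = qphi Q y" if "y \<in> cball x 1" for y
    using tendsto_uniform_limitI[OF l that] qphi_LIMSEQ[OF assms] LIMSEQ_unique by blast
  then have "uniform_limit (cball x 1) (\<lambda>n x. \<Prod>k<n. 1 - Q ^ k * x) (qphi Q) sequentially"
    using l uniform_limit_cong'[of "cball x 1"] by (metis (no_types, lifting))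
  then show "\<exists>d>0. cball x d \<subseteq> UNIV \<and> uniform_limit (cball x d) (\<lambda>n x. \<Prod>k<n. 1 - Q ^ k * x) (qphi Q) sequentially"
    by (intro exI[of _ 1]) auto
qed auto

lemma periodic_int_mult:
  fixes f :: "complex \<Rightarrow> complex"
  assumes "\<And>z. f (z + p) = f z"
  shows "f (z + of_int n * p) = f z"
proof -
  have nat: "f (z + of_nat k * p) = f z" for z k
  proof (induction k)
    case (Suc k)
    have "f (z + of_nat (Suc k) * p) = f ((z + of_nat k * p) + p)" by (simp add: algebra_simps)
    then show ?case using assms Suc by simp
  qed simp
  show ?thesis
  proof (cases n rule: int_cases2)
    case (nonneg k)
    then show ?thesis using nat by simp
  next
    case (nonpos k)
    then show ?thesis using nat[of "z + of_int n * p" k] by simp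
  qed
qed

text \<open>The modified Jacobi theta function, whose zeros are the integral powers of
  \<open>Q\<close>.\<close>

definition tprod :: "complex \<Rightarrow> complex \<Rightarrow> complex" where
  "tprod Q x = qphi Q x * qphi Q (Q / x)"

text \<open>Passing from x to Qx removes the factor 1 - x from the first product and adds 1 - 1/x to
  the second; the ratio is -1/x.\<close>

lemma tprod_mult:
  assumes "norm Q < 1" "x \<noteq> 0" "Q \<noteq> 0"
  shows "tprod Q (Q * x) = - tprod Q x / x"
proof -
  have "tprod Q (Q * x) = qphi Q (Q * x) * qphi Q (1 / x)"
    using assms by (simp add: tprod_def)
  also have "qphi Q (1 / x) = (1 - 1 / x) * qphi Q (Q / x)"
    using qphi_step[OF assms(1), of "1 / x"] by simp
  also have "1 - 1 / x = - (1 - x) / x" using assms by (simp add: field_simps)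
  also have "qphi Q (Q * x) * (- (1 - x) / x * qphi Q (Q / x)) = - ((1 - x) * qphi Q (Q * x) * qphi Q (Q / x)) / x"
    by (simp add: algebra_simps)
  also have "(1 - x) * qphi Q (Q * x) = qphi Q x" using qphi_step[OF assms(1), of x] by simp
  finally show ?thesis by (simp add: tprod_def)
qed

lemma tprod_inverse:
  assumes "norm Q < 1" "x \<noteq> 0"
  shows "tprod Q (1 / x) = - tprod Q x / x"
proof -
  have "tprod Q (1 / x) = qphi Q (1 / x) * qphi Q (Q * x)"
    using assms by (simp add: tprod_def)
  also have "qphi Q (1 / x) = (1 - 1 / x) * qphi Q (Q / x)"
    using qphi_step[OF assms(1), of "1 / x"] by simp
  also have "1 - 1 / x = - (1 - x) / x" using assms by (simp add: field_simps)
  also have "- (1 - x) / x * qphi Q (Q / x) * qphi Q (Q * x) = - ((1 - x) * qphi Q (Q * x) * qphi Q (Q / x)) / x"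
    by (simp add: algebra_simps)
  also have "(1 - x) * qphi Q (Q * x) = qphi Q x" using qphi_step[OF assms(1), of x] by simp
  finally show ?thesis by (simp add: tprod_def)
qed

lemma tprod_1: "norm Q < 1 \<Longrightarrow> tprod Q 1 = 0"
  using qphi_step[of Q 1] by (simp add: tprod_def)

section \<open>A theta function vanishing exactly on the lattice\<close>

context upper_half_plane
begin

definition e :: "complex \<Rightarrow> complex" where "e z = exp (2 * of_real pi * \<i> * z)"
definition Q :: complex where "Q = e \<tau>"
text \<open>Plays the role of the Weierstrass sigma function: periodic under 1, quasi-periodic under
  \<tau>, with zeros only at lattice points.\<close>

definition S :: "complex \<Rightarrow> complex" where "S z = tprod Q (e z)"
definition E :: complex where "E = qphi Q Q"

lemma e_nz [simp]: "e z \<noteq> 0" by (simp add: e_def)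
lemma e_0 [simp]: "e 0 = 1" by (simp add: e_def)
lemma e_add: "e (z + w) = e z * e w" by (simp add: e_def exp_add algebra_simps)
lemma e_diff: "e (z - w) = e z / e w" by (simp add: e_def exp_diff algebra_simps)
lemma e_uminus: "e (- z) = 1 / e z" by (simp add: e_def exp_minus inverse_eq_divide)
lemma e_1 [simp]: "e 1 = 1" unfolding e_def by (metis exp_two_pi_i mult.right_neutral mult.commute mult.assoc)
lemma e_mult_nat: "e (of_nat n * z) = e z ^ n"
  by (simp add: e_def exp_of_nat_mult[symmetric] algebra_simps)

lemma Q_bounds: "norm Q < 1" "Q \<noteq> 0"
  using Im_tau by (simp_all add: Q_def e_def)

lemma E_nz: "E \<noteq> 0" unfolding E_def by (rule qphi_nonzero'[OF Q_bounds(1) Q_bounds(1)])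

lemma S_add_1: "S (z + 1) = S z" by (simp add: S_def e_add)
lemma S_add_tau: "S (z + \<tau>) = - S z / e z"
  using tprod_mult[OF Q_bounds(1) _ Q_bounds(2), of "e z"] by (simp add: S_def e_add Q_def mult.commute)
lemma S_uminus: "S (- z) = - S z / e z"
  using tprod_inverse[OF Q_bounds(1), of "e z"] by (simp add: S_def e_uminus)
lemma S_0: "S 0 = 0" by (simp add: S_def tprod_1 Q_bounds)

lemma e_eq_1_imp:
  assumes "e z = 1"
  shows "\<exists>n. z = of_int n"
proof -
  obtain n :: int where "Im z = 0" and n: "2 * pi * Re z = of_int (2 * n) * pi"
    using assms unfolding e_def exp_eq_1 by auto
  then have "z = of_int n" by (simp add: complex_eq_iff)
  then show ?thesis by blast
qed

text \<open>A vanishing factor means that k \<tau> + w is an integer, so that w is a lattice point.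
  The second product has this shape with w = \<tau> - z.\<close>

lemma S_nonzero:
  assumes "z \<notin> L"
  shows "S z \<noteq> 0"
proof -
  have 1: "Q ^ k * e w \<noteq> 1" if "w \<notin> L" for k w
  proof
    assume "Q ^ k * e w = 1"
    then have "e (of_nat k * \<tau> + w) = 1" by (simp add: e_add e_mult_nat Q_def)
    then obtain n where n: "of_nat k * \<tau> + w = of_int n" using e_eq_1_imp by blast
    then have "w = of_int n + of_int (- int k) * \<tau>" by (simp add: algebra_simps)
    then show False using that unfolding lattice_unit by blast
  qed
  have "\<tau> - z \<notin> L"
  proof
    assume "\<tau> - z \<in> L"
    then have "\<tau> - (\<tau> - z) \<in> L" by (rule L_diff[OF L_tau])
    then show False using assms by simp
  qed
  moreover have "Q / e z = e (\<tau> - z)" by (simp add: e_diff Q_def)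
  ultimately show ?thesis
    unfolding S_def tprod_def mult_eq_0_iff de_Morgan_disj
    using 1 assms by (intro conjI qphi_nonzero[OF Q_bounds(1)]) auto
qed

lemma e_holomorphic [holomorphic_intros]: "f holomorphic_on A \<Longrightarrow> (\<lambda>z. e (f z)) holomorphic_on A"
  unfolding e_def by (intro holomorphic_intros)

lemma qphi_holomorphic' [holomorphic_intros]:
  "f holomorphic_on A \<Longrightarrow> (\<lambda>z. qphi Q (f z)) holomorphic_on A"
  using holomorphic_on_compose_gen[OF _ qphi_holomorphic[OF Q_bounds(1)], of f A] by (auto simp: o_def)

lemma S_holomorphic [holomorphic_intros]: "f holomorphic_on A \<Longrightarrow> (\<lambda>z. S (f z)) holomorphic_on A"
  unfolding S_def tprod_def by (intro holomorphic_intros) auto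

text \<open>The factor 1 - e z carries the simple zero, with derivative -2 pi i; the two remaining
  products each tend to \<open>E\<close>.\<close>

lemma S_quotient_limit: "((\<lambda>z. S z / z) \<longlongrightarrow> - (2 * of_real pi * \<i>) * E ^ 2) (at 0)"
proof -
  define U where "U = (\<lambda>z. qphi Q (Q * e z) * qphi Q (Q / e z))"
  have "U holomorphic_on UNIV" unfolding U_def by (intro holomorphic_intros) auto
  then have "isCont U 0"
    using holomorphic_on_imp_continuous_on continuous_on_interior by fastforce
  then have U: "(U \<longlongrightarrow> E ^ 2) (at 0)"
    by (simp add: isCont_def U_def E_def power2_eq_square)
  have "(e has_field_derivative (2 * of_real pi * \<i>)) (at 0)"
    unfolding e_def by (auto intro!: derivative_eq_intros)
  then have "((\<lambda>z. (e z - 1) / z) \<longlongrightarrow> 2 * of_real pi * \<i>) (at 0)"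
    by (simp add: has_field_derivative_iff)
  then have "((\<lambda>z. - ((e z - 1) / z) * U z) \<longlongrightarrow> - (2 * of_real pi * \<i>) * E ^ 2) (at 0)"
    by (intro tendsto_mult tendsto_minus U)
  moreover have "- ((e z - 1) / z) * U z = S z / z" for z
    using qphi_step[OF Q_bounds(1), of "e z"] by (simp add: S_def tprod_def U_def minus_divide_left)
  ultimately show ?thesis by simp
qed

lemma L_induct_periodic:
  assumes "\<And>z. f (z + 1) = f z" "\<And>z. f (z + \<tau>) = f z" "l \<in> L"
  shows "f (z + l) = (f z :: complex)"
proof -
  obtain m n where "l = of_int m + of_int n * \<tau>" using assms(3) by (auto simp: lattice_unit)
  then have "f (z + l) = f ((z + of_int m * 1) + of_int n * \<tau>)" by (simp add: add.assoc)
  also have "\<dots> = f (z + of_int m * 1)" by (rule periodic_int_mult[where f = f, OF assms(2)])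
  also have "\<dots> = f z" by (rule periodic_int_mult[where f = f, OF assms(1)])
  finally show ?thesis .
qed

text \<open>The limit condition leaves at most a simple pole at the origin, which evenness excludes;
  Liouville's theorem does the rest.\<close>

lemma even_elliptic_constant:
  fixes h :: "complex \<Rightarrow> complex"
  assumes diff: "\<And>z. z \<notin> L \<Longrightarrow> h field_differentiable (at z)"
    and periodic: "\<And>z l. l \<in> L \<Longrightarrow> h (z + l) = h z"
    and even: "\<And>z. h (- z) = h z"
    and lim: "((\<lambda>z. z ^ 2 * h z) \<longlongrightarrow> 0) (at 0)"
    and "z \<notin> L" "w \<notin> L"
  shows "h z = h w"
proof -
  obtain r where r: "r > 0" "\<And>\<omega>. \<omega> \<in> L \<Longrightarrow> norm \<omega> < r \<Longrightarrow> \<omega> = 0" by (rule discrete_L) auto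
  have hol: "h holomorphic_on (ball 0 r - {0})"
    unfolding holomorphic_on_def
  proof
    fix z :: complex assume "z \<in> ball 0 r - {0}"
    then have "z \<notin> L" using r(2)[of z] by auto
    then show "h field_differentiable (at z within ball 0 r - {0})"
      by (rule field_differentiable_at_within[OF diff])
  qed
  have "\<exists>g. g holomorphic_on ball 0 r \<and> (\<forall>z\<in>ball 0 r - {0}. g z = z * h z)"
  proof (subst holomorphic_on_extend_lim)
    show "((\<lambda>z. (z - 0) * (z * h z)) \<longlongrightarrow> 0) (at 0)"
      using lim by (simp add: power2_eq_square mult.assoc)
  qed (use r(1) hol in \<open>auto intro!: holomorphic_intros\<close>)
  then obtain k where k: "k holomorphic_on ball 0 r" "\<And>z. z \<in> ball 0 r - {0} \<Longrightarrow> k z = z * h z" by blast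
  have kc: "isCont k 0"
    using holomorphic_on_imp_continuous_on[OF k(1)] r(1) by (simp add: continuous_on_eq_continuous_at)
  have k0: "(\<lambda>z. z * h z) \<midarrow>0\<rightarrow> k 0"
  proof (rule Lim_transform_within_open[of k "k 0" 0 UNIV "ball 0 r"])
    show "k \<midarrow>0\<rightarrow> k 0" using kc by (simp add: isCont_def)
  qed (use r(1) k(2) in auto)
  have "filterlim (\<lambda>z::complex. - z) (at 0) (at 0)"
    unfolding filterlim_at by (auto intro!: tendsto_eq_intros simp: eventually_at_filter)
  then have "(\<lambda>z. (- z) * h (- z)) \<midarrow>0\<rightarrow> k 0"
    by (rule filterlim_compose[OF k0])
  then have "(\<lambda>z. - (z * h z)) \<midarrow>0\<rightarrow> k 0" by (simp add: even)
  moreover have "(\<lambda>z. - (z * h z)) \<midarrow>0\<rightarrow> - k 0" by (intro tendsto_minus k0)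
  ultimately have "k 0 = - k 0" by (rule LIM_unique)
  then have "k 0 = 0" by simp
  have "\<exists>g. g holomorphic_on ball 0 r \<and> (\<forall>z\<in>ball 0 r - {0}. g z = h z)"
  proof (subst holomorphic_on_extend_lim)
    show "((\<lambda>z. (z - 0) * h z) \<longlongrightarrow> 0) (at 0)" using k0 \<open>k 0 = 0\<close> by simp
  qed (use r(1) hol in auto)
  then obtain g where g: "g holomorphic_on ball 0 r" "\<And>z. z \<in> ball 0 r - {0} \<Longrightarrow> g z = h z" by blast
  \<comment> \<open>Using the removable value at 0 for every lattice point keeps the extension
    periodic.\<close>
  define H where "H = (\<lambda>z. if z \<in> L then g 0 else h z)"
  have Hper: "H (z + l) = H z" if "l \<in> L" for z l
    using that by (simp add: H_def L_add_iff periodic)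
  have H0: "H field_differentiable (at 0)"
  proof -
    have "H holomorphic_on ball 0 r"
    proof (rule holomorphic_transform[OF g(1)])
      fix x :: complex assume "x \<in> ball 0 r"
      then show "g x = H x" using r(2)[of x] g(2)[of x] by (cases "x = 0") (auto simp: H_def)
    qed
    then show ?thesis using r(1) by (intro holomorphic_on_imp_differentiable_at[of _ "ball 0 r"]) auto
  qed
  have Hdiff: "H field_differentiable (at z)" for z
  proof (cases "z \<in> L")
    case True
    have "(H \<circ> (\<lambda>t. t - z)) field_differentiable (at z)"
      by (rule field_differentiable_compose) (use H0 in \<open>auto intro!: derivative_intros\<close>)
    moreover have "H \<circ> (\<lambda>t. t - z) = H"
      using Hper[OF L_uminus[OF True]] by (simp add: fun_eq_iff)
    ultimately show ?thesis by simp
  next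
    case False
    have "h holomorphic_on - L"
      unfolding holomorphic_on_def using field_differentiable_at_within[OF diff] by simp
    then have "H holomorphic_on - L"
      by (rule holomorphic_transform) (auto simp: H_def)
    then show ?thesis
      using False open_minus_L by (intro holomorphic_on_imp_differentiable_at[of _ "- L"]) auto
  qed
  have Hhol: "H holomorphic_on UNIV"
    unfolding holomorphic_on_def using field_differentiable_at_within[OF Hdiff] by blast
  \<comment> \<open>The closed fundamental parallelogram: reducing both real coordinates modulo 1
    shows that it carries all values of \<open>H\<close>.\<close>
  define P where "P = (\<lambda>(s, t). of_real s + of_real t * \<tau>) ` (cbox (0::real) 1 \<times> cbox (0::real) 1)"
  have "compact P"
    unfolding P_def case_prod_unfold by (intro compact_continuous_image compact_Times compact_cbox continuous_intros)
  then have "compact (H ` P)"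
    using holomorphic_on_imp_continuous_on[OF Hhol] continuous_on_subset
    by (intro compact_continuous_image) blast+
  moreover have "range H \<subseteq> H ` P"
  proof clarify
    fix z
    define t where "t = Im z / Im \<tau>"
    define s where "s = Re z - t * Re \<tau>"
    have z: "z = of_real s + of_real t * \<tau>"
      using Im_tau by (simp add: complex_eq_iff s_def t_def)
    have "z = (of_real (frac s) + of_real (frac t) * \<tau>) + (of_int \<lfloor>s\<rfloor> + of_int \<lfloor>t\<rfloor> * \<tau>)"
      unfolding z by (simp add: frac_def algebra_simps)
    moreover have "of_int \<lfloor>s\<rfloor> + of_int \<lfloor>t\<rfloor> * \<tau> \<in> L" unfolding lattice_unit by blast
    ultimately have "H z = H (of_real (frac s) + of_real (frac t) * \<tau>)"
      using Hper by metis
    moreover have "of_real (frac s) + of_real (frac t) * \<tau> \<in> P"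
      unfolding P_def using frac_lt_1[of s] frac_lt_1[of t]
      by (intro image_eqI[of _ _ "(frac s, frac t)"]) auto
    ultimately show "H z \<in> H ` P" by simp
  qed
  ultimately have "bounded (range H)"
    using compact_imp_bounded bounded_subset by blast
  then have "H constant_on UNIV" using Liouville_theorem[OF Hhol] by blast
  then have "H z = H w" by (auto simp: constant_on_def)
  then show ?thesis using assms by (simp add: H_def)
qed

text \<open>The sigma quotient for a difference of Weierstrass values. In z, both S(z+w) S(z-w) /
  S(z)^2 and \<open>wp\<close> are even and elliptic with a double pole at 0; a suitable combination
  is constant, and z = w gives the constant.\<close>

lemma wp_diff_tprod:
  assumes z: "z \<notin> L" and w: "w \<notin> L"
  shows "(wp z - wp w) * S w ^ 2 * S z ^ 2 = 4 * of_real pi ^ 2 * E ^ 4 * e w * S (z + w) * S (z - w)"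
proof -
  \<comment> \<open>\<open>c\<close> is the limit of z^2 G(z) at 0: there S(z) behaves like -2 pi i
    E^2 z, and S(-w) = -S(w) / e(w).\<close>
  define c where "c = S w ^ 2 / (4 * of_real pi ^ 2 * E ^ 4 * e w)"
  define G where "G = (\<lambda>z. S (z + w) * S (z - w) / S z ^ 2)"
  define h where "h = (\<lambda>z. G z - c * wp z)"
  have "h z = h w"
  proof (rule even_elliptic_constant[where h = h and z = z and w = w])
    show "h field_differentiable (at z)" if "z \<notin> L" for z
    proof -
      have "G holomorphic_on - L" unfolding G_def
        by (intro holomorphic_intros) (auto simp: S_nonzero)
      then have "G field_differentiable (at z)"
        using that open_minus_L by (intro holomorphic_on_imp_differentiable_at[of _ "- L"]) auto
      then show ?thesis unfolding h_def
        by (intro field_differentiable_diff field_differentiable_mult field_differentiable_const wp_differentiable that)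
    qed
    show "h (z + l) = h z" if "l \<in> L" for z l
    proof (rule L_induct_periodic[where f = h, OF _ _ that])
      show "h (z + 1) = h z" for z
      proof -
        have "S (z + 1 + w) = S (z + w)" "S (z + 1 - w) = S (z - w)"
          using S_add_1[of "z + w"] S_add_1[of "z - w"] by (simp_all add: algebra_simps)
        then show ?thesis by (simp add: h_def G_def S_add_1 wp_periodic)
      qed
      show "h (z + \<tau>) = h z" for z
      proof -
        \<comment> \<open>The multipliers at z + w and z - w combine to 1 / e(z)^2, which is also
          the multiplier of S(z)^2.\<close>
        have 1: "S (z + \<tau> + w) = - S (z + w) / (e z * e w)"
          using S_add_tau[of "z + w"] by (simp add: e_add algebra_simps)
        have 2: "S (z + \<tau> - w) = - S (z - w) / (e z / e w)"
          using S_add_tau[of "z - w"] by (simp add: e_diff algebra_simps)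
        show ?thesis
          by (simp add: h_def G_def 1 2 S_add_tau wp_periodic power_divide power2_eq_square)
      qed
    qed
    show "h (- z) = h z" for z
    proof -
      have 1: "S (- z + w) = - S (z - w) / (e z / e w)"
        using S_uminus[of "z - w"] by (simp add: e_diff)
      have 2: "S (- z - w) = - S (z + w) / (e z * e w)"
        using S_uminus[of "z + w"] by (simp add: e_add)
      show ?thesis
        unfolding h_def G_def 1 2 S_uminus[of z] wp_uminus by (simp add: power_divide power2_eq_square)
    qed
    show "((\<lambda>z. z ^ 2 * h z) \<longlongrightarrow> 0) (at 0)"
    proof -
      obtain r g where g: "r > 0" "\<And>\<omega>. \<omega> \<in> L \<Longrightarrow> norm \<omega> < r \<Longrightarrow> \<omega> = 0"
          "g holomorphic_on ball 0 r" "\<And>z. z \<in> ball 0 r \<Longrightarrow> wp z = 1 / z ^ 2 + g z"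
        by (rule wp_near_0) auto
      have gc: "g \<midarrow>0\<rightarrow> g 0"
        using holomorphic_on_imp_continuous_on[OF g(3)] g(1)
        by (simp add: continuous_on_eq_continuous_at isCont_def)
      have "(\<lambda>z. 1 + z ^ 2 * g z) \<midarrow>0\<rightarrow> 1 + 0 ^ 2 * g 0"
        by (intro tendsto_intros gc)
      then have wp_lim: "(\<lambda>z. z ^ 2 * wp z) \<midarrow>0\<rightarrow> 1 + 0 ^ 2 * g 0"
        by (rule Lim_transform_within_open[of _ _ _ _ "ball 0 r"]) (use g(1,4) in \<open>auto simp: distrib_left\<close>)
      have "(\<lambda>z. S (z + w) * S (z - w)) holomorphic_on UNIV" by (intro holomorphic_intros)
      then have "isCont (\<lambda>z. S (z + w) * S (z - w)) 0"
        using holomorphic_on_imp_continuous_on continuous_on_interior by fastforce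
      then have SS: "(\<lambda>z. S (z + w) * S (z - w)) \<midarrow>0\<rightarrow> S w * S (- w)" by (simp add: isCont_def)
      have "(\<lambda>z. S (z + w) * S (z - w) / (S z / z) ^ 2 - c * (z ^ 2 * wp z)) \<midarrow>0\<rightarrow>
          S w * S (- w) / (- (2 * of_real pi * \<i>) * E ^ 2) ^ 2 - c * (1 + 0 ^ 2 * g 0)"
        using E_nz
        by (intro tendsto_diff tendsto_divide[OF SS] tendsto_power S_quotient_limit
            tendsto_mult[OF tendsto_const wp_lim]) auto
      moreover have "S w * S (- w) / (- (2 * of_real pi * \<i>) * E ^ 2) ^ 2 - c * (1 + 0 ^ 2 * g 0) = 0"
      proof -
        have 1: "(- (2 * of_real pi * \<i>) * E ^ 2) ^ 2 = - (4 * of_real pi ^ 2 * E ^ 4)"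
          by (simp add: power_mult_distrib power_mult[symmetric])
        have "s * (- s / y) / - X = s ^ 2 / (X * y)" for s X y :: complex
          by (simp add: power2_eq_square)
        then have "S w * S (- w) / (- (2 * of_real pi * \<i>) * E ^ 2) ^ 2 = c"
          unfolding 1 S_uminus[of w] c_def by this
        then show ?thesis by simp
      qed
      moreover have "S (z + w) * S (z - w) / (S z / z) ^ 2 - c * (z ^ 2 * wp z) = z ^ 2 * h z" for z
        by (simp add: h_def G_def power_divide right_diff_distrib)
      ultimately show ?thesis by simp
    qed
  qed (use z w in auto)
  \<comment> \<open>The quotient vanishes at z = w because S 0 = 0.\<close>
  then have "G z - c * wp z = - c * wp w" by (simp add: h_def G_def S_0)
  then have "c * (wp z - wp w) = S (z + w) * S (z - w) / S z ^ 2" by (simp add: G_def algebra_simps)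
  then show ?thesis
    using S_nonzero[OF z] E_nz by (simp add: c_def field_simps)
qed

end

section \<open>Values at the half periods\<close>

context upper_half_plane
begin

definition q :: complex where "q = exp (of_real pi * \<i> * \<tau>)"

lemma q_eq_e: "q = e (\<tau> / 2)" by (simp add: q_def e_def mult.assoc)
lemma Q_eq: "Q = q ^ 2"
  unfolding q_eq_e Q_def power2_eq_square e_add[symmetric] by simp
lemma q_bounds: "norm q < 1" "q \<noteq> 0" using Im_tau by (simp_all add: q_def)
lemma e_half: "e (1 / 2) = -1" by (simp add: e_def)

lemma half_period_notin_L: "1 / 2 \<notin> L" "\<tau> / 2 \<notin> L" "(1 + \<tau>) / 2 \<notin> L"
proof -
  have *: "even m \<and> even n" if eq: "of_int m + of_int n * \<tau> = 2 * z" and z: "z \<in> L" for m n z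
  proof -
    obtain m' n' where "z = of_int m' + of_int n' * \<tau>" using z unfolding lattice_unit by blast
    then have "(\<lambda>(m, n). of_int m + of_int n * \<tau>) (m, n) = (\<lambda>(m, n). of_int m + of_int n * \<tau>) (2 * m', 2 * n')"
      using eq by (simp add: algebra_simps)
    then have "(m, n) = (2 * m', 2 * n')" by (rule injD[OF of_int_add_mult_tau_inj])
    then show ?thesis by simp
  qed
  show "1 / 2 \<notin> L" using *[of 1 0 "1 / 2"] by auto
  show "\<tau> / 2 \<notin> L" using *[of 0 1 "\<tau> / 2"] by auto
  show "(1 + \<tau>) / 2 \<notin> L" using *[of 1 1 "(1 + \<tau>) / 2"] by auto
qed

text \<open>Sum and difference of two half periods agree with the third modulo the lattice. Hence
  each difference of values is, up to explicit factors, the square of the third value of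
  \<open>S\<close> over the squares of the other two, and the product involves A, B, C only through
  ABC.\<close>

lemma wp_half_period_differences:
  "((wp (1 / 2) - wp ((1 + \<tau>) / 2)) * (wp (1 / 2) - wp (\<tau> / 2)) * (wp ((1 + \<tau>) / 2) - wp (\<tau> / 2))) ^ 2
    = 2 ^ 8 * of_real pi ^ 12 * q ^ 2 * E ^ 24"
proof -
  define A where "A = S (1 / 2)"
  define B where "B = S (\<tau> / 2)"
  define C where "C = S ((1 + \<tau>) / 2)"
  define k where "k = 4 * of_real pi ^ 2 * E ^ 4"
  have e3: "e ((1 + \<tau>) / 2) = - q"
    by (simp add: add_divide_distrib e_add e_half q_eq_e)
  \<comment> \<open>At the half periods \<open>e\<close> equals -1, q and -q. As Q/q = q, both
    products in \<open>S\<close> coincide for B and C; for A the extra factor 1 - (-1) gives the 2.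
    Euler's identity evaluates the rest.\<close>
  have ABC: "A * B * C = 2"
  proof -
    have "A = 2 * qphi Q (- Q) ^ 2"
      using qphi_step[OF Q_bounds(1), of "-1"] by (simp add: A_def S_def e_half tprod_def power2_eq_square)
    moreover have "B = qphi Q q ^ 2"
      using q_bounds by (simp add: B_def S_def q_eq_e[symmetric] tprod_def Q_eq power2_eq_square)
    moreover have "C = qphi Q (- q) ^ 2"
      using q_bounds by (simp add: C_def S_def e3 tprod_def Q_eq power2_eq_square)
    ultimately have "A * B * C = 2 * (qphi Q (- Q) * qphi Q q * qphi Q (- q)) ^ 2"
      by (simp add: power_mult_distrib)
    also have "qphi Q (- Q) * qphi Q q * qphi Q (- q) = 1"
      using qphi_euler[OF q_bounds(1)] by (simp add: Q_eq)
    finally show ?thesis by simp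
  qed
  have 1: "(wp (1 / 2) - wp (\<tau> / 2)) * B ^ 2 * A ^ 2 = k * C ^ 2"
  proof -
    \<comment> \<open>The prefactor e(\<tau>/2) = q of the difference formula is exactly the
      multiplier for the shift by \<tau>.\<close>
    have "q * S (1 / 2 - \<tau> / 2) = C"
    proof -
      have "C = - S (1 / 2 - \<tau> / 2) / e (1 / 2 - \<tau> / 2)"
        using S_add_tau[of "1 / 2 - \<tau> / 2"] by (simp add: C_def add_divide_distrib algebra_simps)
      also have "e (1 / 2 - \<tau> / 2) = - 1 / q" by (simp add: e_diff e_half q_eq_e)
      finally show ?thesis by simp
    qed
    moreover have "S (1 / 2 + \<tau> / 2) = C" by (simp add: C_def add_divide_distrib)
    moreover have "(wp (1 / 2) - wp (\<tau> / 2)) * B ^ 2 * A ^ 2 = k * S (1 / 2 + \<tau> / 2) * (q * S (1 / 2 - \<tau> / 2))"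
      using wp_diff_tprod[OF half_period_notin_L(1,2)] by (simp add: A_def B_def k_def q_eq_e mult_ac)
    ultimately show ?thesis by (simp add: power2_eq_square)
  qed
  have 2: "(wp (1 / 2) - wp ((1 + \<tau>) / 2)) * C ^ 2 * A ^ 2 = k * B ^ 2"
  proof -
    have "S (1 / 2 - (1 + \<tau>) / 2) = - B / q"
      using S_uminus[of "\<tau> / 2"] by (simp add: B_def q_eq_e add_divide_distrib)
    moreover have "S (1 / 2 + (1 + \<tau>) / 2) = B"
      using S_add_1[of "\<tau> / 2"] by (simp add: B_def add_divide_distrib algebra_simps)
    ultimately show ?thesis
      using wp_diff_tprod[OF half_period_notin_L(1,3)] q_bounds(2)
      by (simp add: A_def[symmetric] C_def[symmetric] k_def e3 power2_eq_square)
  qed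
  have 3: "(wp ((1 + \<tau>) / 2) - wp (\<tau> / 2)) * B ^ 2 * C ^ 2 = k * q * A ^ 2"
  proof -
    have "S ((1 + \<tau>) / 2 - \<tau> / 2) = A"
      by (simp add: A_def add_divide_distrib)
    moreover have "S ((1 + \<tau>) / 2 + \<tau> / 2) = A"
      using S_add_tau[of "1 / 2"] by (simp add: A_def e_half add_divide_distrib add.assoc)
    ultimately show ?thesis
      using wp_diff_tprod[OF half_period_notin_L(3,2)]
      by (simp add: B_def C_def k_def q_eq_e power2_eq_square mult.assoc)
  qed
  define P where "P = (wp (1 / 2) - wp ((1 + \<tau>) / 2)) * (wp (1 / 2) - wp (\<tau> / 2)) * (wp ((1 + \<tau>) / 2) - wp (\<tau> / 2))"
  have "P * (A * B * C) ^ 4 = ((wp (1 / 2) - wp ((1 + \<tau>) / 2)) * C ^ 2 * A ^ 2) *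
      ((wp (1 / 2) - wp (\<tau> / 2)) * B ^ 2 * A ^ 2) * ((wp ((1 + \<tau>) / 2) - wp (\<tau> / 2)) * B ^ 2 * C ^ 2)"
    by (simp add: P_def power2_eq_square power4_eq_xxxx mult_ac)
  also have "\<dots> = k ^ 3 * q * (A * B * C) ^ 2"
    unfolding 1 2 3 by (simp add: power2_eq_square power3_eq_cube mult_ac)
  finally have P: "P = k ^ 3 * q / 4" unfolding ABC by (simp add: mult_ac)
  have "P ^ 2 = (k ^ 3) ^ 2 * q ^ 2 / 16" unfolding P by (simp add: power_mult_distrib power_divide)
  also have "(k ^ 3) ^ 2 = 2 ^ 12 * of_real pi ^ 12 * E ^ 24"
    by (simp add: k_def power_mult_distrib power_mult[symmetric])
  finally show ?thesis by (simp add: P_def)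
qed

section \<open>Passage to a general lattice\<close>

lemma lattice_scale:
  assumes "\<omega>\<^sub>1 \<noteq> 0" "\<tau> = \<omega>\<^sub>2 / \<omega>\<^sub>1"
  shows "lattice \<omega>\<^sub>1 \<omega>\<^sub>2 = (\<lambda>l. \<omega>\<^sub>1 * l) ` L"
proof -
  have "lattice \<omega>\<^sub>1 \<omega>\<^sub>2 = {\<omega>\<^sub>1 * (of_int m + of_int n * \<tau>) | m n. True}"
    unfolding lattice_def assms(2) using assms(1) by (simp add: distrib_left mult_ac)
  then show ?thesis by (auto simp: lattice_unit)
qed

text \<open>Every term of the series is homogeneous of degree -2 in the argument and the lattice
  point jointly.\<close>

lemma weierstrass_P_scale:
  assumes "\<omega>\<^sub>1 \<noteq> 0" "\<tau> = \<omega>\<^sub>2 / \<omega>\<^sub>1"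
  shows "weierstrass_P (lattice \<omega>\<^sub>1 \<omega>\<^sub>2) s = wp (s / \<omega>\<^sub>1) / \<omega>\<^sub>1 ^ 2"
proof -
  have "infsum (\<lambda>\<omega>. 1 / (s + \<omega>) ^ 2 - 1 / \<omega> ^ 2) (lattice \<omega>\<^sub>1 \<omega>\<^sub>2 - {0}) =
     infsum (\<lambda>l. 1 / \<omega>\<^sub>1 ^ 2 * (1 / (s / \<omega>\<^sub>1 + l) ^ 2 - 1 / l ^ 2)) (L - {0})"
  proof (rule infsum_reindex_bij_witness[of _ "\<lambda>l. \<omega>\<^sub>1 * l" "\<lambda>\<omega>. \<omega> / \<omega>\<^sub>1"])
    fix \<omega>
    have "s + \<omega> = \<omega>\<^sub>1 * (s / \<omega>\<^sub>1 + \<omega> / \<omega>\<^sub>1)" "\<omega> = \<omega>\<^sub>1 * (\<omega> / \<omega>\<^sub>1)"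
      using assms(1) by (simp_all add: field_simps)
    then have "1 / (s + \<omega>) ^ 2 = 1 / (\<omega>\<^sub>1 * (s / \<omega>\<^sub>1 + \<omega> / \<omega>\<^sub>1)) ^ 2" "1 / \<omega> ^ 2 = 1 / (\<omega>\<^sub>1 * (\<omega> / \<omega>\<^sub>1)) ^ 2"
      by simp_all
    then show "1 / \<omega>\<^sub>1 ^ 2 * (1 / (s / \<omega>\<^sub>1 + \<omega> / \<omega>\<^sub>1) ^ 2 - 1 / (\<omega> / \<omega>\<^sub>1) ^ 2) = 1 / (s + \<omega>) ^ 2 - 1 / \<omega> ^ 2"
      by (simp only: power_mult_distrib right_diff_distrib times_divide_times_eq mult_1_left)
  qed (use assms(1) in \<open>auto simp: lattice_scale[OF assms]\<close>)
  also have "\<dots> = 1 / \<omega>\<^sub>1 ^ 2 * infsum (\<lambda>l. 1 / (s / \<omega>\<^sub>1 + l) ^ 2 - 1 / l ^ 2) (L - {0})"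
    by (rule infsum_cmult_right')
  finally show ?thesis
    using assms(1)
    unfolding weierstrass_P_eq_wp[symmetric] weierstrass_P_def by (simp add: add_divide_distrib power_divide)
qed

text \<open>As 2h is a period and \<open>wp\<close> is even, \<open>wp\<close> is symmetric about h,
  so its derivative there equals its own negative.\<close>

lemma deriv_weierstrass_P_half_period:
  assumes "\<omega>\<^sub>1 \<noteq> 0" "\<tau> = \<omega>\<^sub>2 / \<omega>\<^sub>1" "h \<notin> L" "2 * h \<in> L"
  shows "deriv (weierstrass_P (lattice \<omega>\<^sub>1 \<omega>\<^sub>2)) (\<omega>\<^sub>1 * h) = 0"
proof -
  let ?p = "weierstrass_P (lattice \<omega>\<^sub>1 \<omega>\<^sub>2)"
  obtain D where D: "(wp has_field_derivative D) (at h)"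
    using wp_differentiable[OF assms(3)] by (auto simp: field_differentiable_def)
  have "((\<lambda>z. wp (2 * h - z)) has_field_derivative D * (0 - 1)) (at h)"
    by (rule DERIV_chain'[where f = "\<lambda>z. 2 * h - z"]) (auto intro!: derivative_eq_intros simp: D)
  moreover have "wp (2 * h - z) = wp z" for z
    using wp_periodic[OF assms(4), of "- z"] wp_uminus[of z] by (simp add: add.commute)
  ultimately have "(wp has_field_derivative - D) (at h)" by simp
  then have "D = - D" using D DERIV_unique by blast
  then have "D = 0" by simp
  then have D0: "(wp has_field_derivative 0) (at ((\<omega>\<^sub>1 * h) / \<omega>\<^sub>1))" using D assms(1) by simp
  have "((\<lambda>s. wp (s / \<omega>\<^sub>1) / \<omega>\<^sub>1 ^ 2) has_field_derivative (0 * (1 / \<omega>\<^sub>1)) / \<omega>\<^sub>1 ^ 2) (at (\<omega>\<^sub>1 * h))"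
    by (intro DERIV_cdivide DERIV_chain'[where f = "\<lambda>s. s / \<omega>\<^sub>1" and g = wp] D0 DERIV_ident)
  then have "(?p has_field_derivative 0) (at (\<omega>\<^sub>1 * h))"
    unfolding weierstrass_P_scale[OF assms(1,2), abs_def] by simp
  then show ?thesis by (rule DERIV_imp_deriv)
qed

end

section \<open>Roots of the Weierstrass cubic and the final formula\<close>

lemma discriminant_of_roots:
  fixes e1 e2 e3 g2 g3 :: complex
  assumes "4 * e1 ^ 3 - g2 * e1 - g3 = 0" "4 * e2 ^ 3 - g2 * e2 - g3 = 0" "4 * e3 ^ 3 - g2 * e3 - g3 = 0"
    and "(e1 - e2) * (e1 - e3) * (e2 - e3) \<noteq> 0"
  shows "g2 ^ 3 - 27 * g3 ^ 2 = 16 * ((e1 - e2) * (e1 - e3) * (e2 - e3)) ^ 2"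
proof -
  have ne: "e1 \<noteq> e2" "e1 \<noteq> e3" "e2 \<noteq> e3" using assms(4) by auto
  \<comment> \<open>Subtracting two root equations and dividing by the nonzero difference of the
    roots recovers Vieta's relations.\<close>
  have "(e1 - e2) * (4 * (e1^2 + e1 * e2 + e2^2) - g2) = 0"
    using assms(1,2) by algebra
  then have g2: "g2 = 4 * (e1^2 + e1 * e2 + e2^2)" using ne by simp
  have "(e1 - e3) * (4 * (e1^2 + e1 * e3 + e3^2) - g2) = 0"
    using assms(1,3) by algebra
  then have "g2 = 4 * (e1^2 + e1 * e3 + e3^2)" using ne by simp
  then have "(e2 - e3) * (e1 + e2 + e3) = 0" using g2 by algebra
  then have "e1 + e2 + e3 = 0" using ne by simp
  then have e3: "e3 = - e1 - e2" by algebra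
  have g3: "g3 = - 4 * e1 * e2 * (e1 + e2)" using assms(1) g2 by algebra
  show ?thesis unfolding g2 g3 e3 by algebra
qed

lemma same_point_sym: "same_point u v \<Longrightarrow> same_point v u"
proof -
  assume "same_point u v"
  then obtain c where "u \<noteq> 0" "v \<noteq> 0" "c \<noteq> 0" "u = c *s v" unfolding same_point_def by blast
  moreover from this have "v = inverse c *s u" by (simp add: vector_smult_assoc)
  ultimately show ?thesis unfolding same_point_def using nonzero_imp_inverse_nonzero by blast
qed

theorem theorem4p3:
  fixes R :: coeff_poly
    and \<phi> :: "3 cpoly"
    and \<omega>\<^sub>1 \<omega>\<^sub>2 \<tau> g\<^sub>2 g\<^sub>3 :: complex
    and \<Lambda> :: "complex set"
    and l11 l12 l13 l21 l22 l23 :: complex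
    and \<alpha> \<gamma> :: complex
    and \<beta> :: "3 \<Rightarrow> complex"
    and P :: "3 \<Rightarrow> complex ^ 3"
    and param :: "complex \<Rightarrow> complex ^ 3"
    and a b c :: complex
  assumes resultant: "quadrics_resultant R"
    and cubic: "is_form 3 \<phi>"
    and nonsingular: "nonsingular_form \<phi>"
    and Lambda: "\<Lambda> = lattice \<omega>\<^sub>1 \<omega>\<^sub>2"
    and tau: "\<tau> = \<omega>\<^sub>2 / \<omega>\<^sub>1" "Im \<tau> > 0"
    and g2: "g\<^sub>2 = inv_g2 \<Lambda>"
    and g3: "g\<^sub>3 = inv_g3 \<Lambda>"
    and D: "l11 * l22 - l12 * l21 \<noteq> 0"
    and weierstrass_form: "\<And>X Y :: complex.
      teval \<phi> (vector [l11 * X + l12 * Y + l13, l21 * X + l22 * Y + l23, 1])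
        = - (Y ^ 2) + 4 * X ^ 3 - g\<^sub>2 * X - g\<^sub>3"
    and param: "\<And>s. param s =
      vector [l11 * weierstrass_P \<Lambda> s + l12 * deriv (weierstrass_P \<Lambda>) s + l13,
              l21 * weierstrass_P \<Lambda> s + l22 * deriv (weierstrass_P \<Lambda>) s + l23, 1]"
    and P: "\<And>i. P i = vector [1, \<alpha> + \<gamma> * \<beta> i, \<beta> i]"
    and beta: "\<And>i. \<beta> i \<noteq> 0"
    and distinct_points: "\<And>i j. i \<noteq> j \<Longrightarrow> \<not> same_point (P i) (P j)"
    and line_meets: "\<And>v :: complex ^ 3. v \<noteq> 0 \<Longrightarrow>
      teval \<phi> v = 0 \<and> v $ 2 = \<alpha> * v $ 1 + \<gamma> * v $ 3 \<longleftrightarrow> (\<exists>i. same_point v (P i))"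
    and half_periods: "same_point (P 1) (param (\<omega>\<^sub>1 / 2))"
      "same_point (P 2) (param ((\<omega>\<^sub>1 + \<omega>\<^sub>2) / 2))"
      "same_point (P 3) (param (\<omega>\<^sub>2 / 2))"
    and a: "a = theta2 0 \<tau>"
    and b: "b = theta3 0 \<tau>"
    and c: "c = theta4 0 \<tau>"
  shows "cubic_discriminant R \<phi>
    = 2 ^ 16 / (l11 * l22 - l12 * l21) ^ 12 * (complex_of_real pi / \<omega>\<^sub>1) ^ 12 * (a * b * c) ^ 8"
proof -
  interpret quadrics_res R by unfold_locales (rule resultant)
  interpret upper_half_plane \<tau> by unfold_locales (rule tau(2))
  have w1: "\<omega>\<^sub>1 \<noteq> 0" using tau by auto
  have half: "\<omega>\<^sub>1 * (1 / 2) = \<omega>\<^sub>1 / 2" "\<omega>\<^sub>1 * ((1 + \<tau>) / 2) = (\<omega>\<^sub>1 + \<omega>\<^sub>2) / 2" "\<omega>\<^sub>1 * (\<tau> / 2) = \<omega>\<^sub>2 / 2"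
    using w1 by (simp_all add: tau(1) field_simps)
  \<comment> \<open>A half period gives a point of the line, hence of the curve. The derivative
    vanishes there, so the affine equation is evaluated at X =
    \<open>wp h / \<omega>\<^sub>1 ^ 2\<close> and Y = 0.\<close>
  have root: "4 * (wp h / \<omega>\<^sub>1 ^ 2) ^ 3 - g\<^sub>2 * (wp h / \<omega>\<^sub>1 ^ 2) - g\<^sub>3 = 0"
    if "h \<notin> L" "2 * h \<in> L" "same_point (P i) (param (\<omega>\<^sub>1 * h))" for h i
  proof -
    have "param (\<omega>\<^sub>1 * h) \<noteq> 0" using that(3) by (simp add: same_point_def)
    then have "teval \<phi> (param (\<omega>\<^sub>1 * h)) = 0"
      using line_meets same_point_sym[OF that(3)] by blast
    moreover have "deriv (weierstrass_P \<Lambda>) (\<omega>\<^sub>1 * h) = 0"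
      unfolding Lambda by (rule deriv_weierstrass_P_half_period[OF w1 tau(1) that(1,2)])
    moreover have "weierstrass_P \<Lambda> (\<omega>\<^sub>1 * h) = wp h / \<omega>\<^sub>1 ^ 2"
      unfolding Lambda using weierstrass_P_scale[OF w1 tau(1)] w1 by simp
    ultimately show ?thesis unfolding param weierstrass_form by simp
  qed
  define e1 where "e1 = wp (1 / 2) / \<omega>\<^sub>1 ^ 2"
  define e2 where "e2 = wp ((1 + \<tau>) / 2) / \<omega>\<^sub>1 ^ 2"
  define e3 where "e3 = wp (\<tau> / 2) / \<omega>\<^sub>1 ^ 2"
  have "2 * (1 / 2) \<in> L" "2 * ((1 + \<tau>) / 2) \<in> L" "2 * (\<tau> / 2) \<in> L"
    using L_add[OF L_one L_tau] by (simp_all add: add_divide_distrib)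
  then have roots: "4 * e1 ^ 3 - g\<^sub>2 * e1 - g\<^sub>3 = 0" "4 * e2 ^ 3 - g\<^sub>2 * e2 - g\<^sub>3 = 0" "4 * e3 ^ 3 - g\<^sub>2 * e3 - g\<^sub>3 = 0"
    unfolding e1_def e2_def e3_def
    using root[OF half_period_notin_L(1), of 1] root[OF half_period_notin_L(3), of 2]
      root[OF half_period_notin_L(2), of 3] half_periods
    unfolding half by simp_all
  have "(e1 - e2) * (e1 - e3) * (e2 - e3) =
      (wp (1 / 2) - wp ((1 + \<tau>) / 2)) * (wp (1 / 2) - wp (\<tau> / 2)) * (wp ((1 + \<tau>) / 2) - wp (\<tau> / 2)) / \<omega>\<^sub>1 ^ 6"
    unfolding e1_def e2_def e3_def diff_divide_distrib[symmetric] times_divide_times_eq power_add[symmetric]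
    by simp
  then have "((e1 - e2) * (e1 - e3) * (e2 - e3)) ^ 2 = 2 ^ 8 * of_real pi ^ 12 * q ^ 2 * E ^ 24 / (\<omega>\<^sub>1 ^ 6) ^ 2"
    unfolding wp_half_period_differences[symmetric] by (simp only: power_divide)
  also have "\<dots> = (of_real pi / \<omega>\<^sub>1) ^ 12 * (2 ^ 8 * q ^ 2 * E ^ 24)"
    by (simp add: power_divide power_mult[symmetric])
  also have "2 ^ 8 * q ^ 2 * E ^ 24 = (a * b * c) ^ 8"
    using theta_product_power8[OF tau(2)] by (simp add: a b c q_def E_def Q_eq)
  finally have prod: "((e1 - e2) * (e1 - e3) * (e2 - e3)) ^ 2 = (of_real pi / \<omega>\<^sub>1) ^ 12 * (a * b * c) ^ 8" .
  \<comment> \<open>Nonvanishing of the theta constants makes the three roots distinct, as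
    \<open>discriminant_of_roots\<close> requires.\<close>
  have "(a * b * c) ^ 8 \<noteq> 0"
    using theta_product_power8[OF tau(2)] E_nz q_bounds(2) by (simp add: a b c q_def E_def Q_eq)
  then have "((e1 - e2) * (e1 - e3) * (e2 - e3)) ^ 2 \<noteq> 0" unfolding prod using w1 by simp
  then have "g\<^sub>2 ^ 3 - 27 * g\<^sub>3 ^ 2 = 16 * ((e1 - e2) * (e1 - e3) * (e2 - e3)) ^ 2"
    by (intro discriminant_of_roots roots) auto
  \<comment> \<open>The factor 16 from the roots and 2^12 from the cubic multiply to 2^16.\<close>
  then show ?thesis
    unfolding cubic_discriminant_weierstrass[OF cubic D weierstrass_form] prod by simp
qed

end
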